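(* Let $M$ be an $n$-dimensional submanifold of codimension $r$ in a locally product Riemannian manifold $(\widetilde{M},\widetilde{g},\widetilde{P})$, with normal connection $\nabla^{\bot}$ vanishing identically (i.e. $l_{\alpha\beta}=0$ for all $\alpha,\beta$). Let $(P,g,u_{\alpha},\xi_{\alpha},(a_{\alpha\beta})_{r})$ be the structure induced on $M$ by $\widetilde P$, and let $\mathcal{A}=(a_{\alpha\beta})_{r}$. If the determinant of the matrix $I_{r}-\mathcal{A}^{2}$ does not vanish at any point $x\in M$, then the induced structure $(P,g,u_{\alpha},\xi_{\alpha},(a_{\alpha\beta})_{r})$ on $M$ is normal if and only if the $(1,1)$-tensor field $P$ commutes with the Weingarten operators, i.e. $PA_{\alpha}=A_{\alpha}P$ for every $\alpha\in\{1,\dots,r\}$.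
   Context: An almost product Riemannian manifold $(\widetilde M,\widetilde g,\widetilde P)$ is a Riemannian manifold $(\widetilde M,\widetilde g)$ with a $(1,1)$-tensor field $\widetilde P$ such that $\widetilde P^2=I$ and $\widetilde g(\widetilde PU,\widetilde PV)=\widetilde g(U,V)$ for all vector fields $U,V$. It is a locally product Riemannian manifold if moreover $\widetilde\nabla\widetilde P=0$, where $\widetilde\nabla$ is the Levi-Civita connection of $\widetilde g$. $M$ is isometrically immersed with induced metric $g$ and Levi-Civita connection $\nabla$; $\chi(M)$ denotes the vector fields on $M$; $(N_1,\dots,N_r)$ is a smooth orthonormal frame of the normal bundle of $M$. The induced structure is defined by the tangential/normal decompositions $$\widetilde P X=PX+\sum_{\alpha}u_\alpha(X)N_\alpha,\qquad \widetilde P N_\alpha=\xi_\alpha+\sum_\beta a_{\alpha\beta}N_\beta\qquad (X\in\chi(M)),$$ where $P$ is a $(1,1)$-tensor field on $M$, $u_\alpha$ are 1-forms, $\xi_\alpha$ are tangent vector fields and $a_{\alpha\beta}$ are real functions on $M$. The Weingarten operators $A_\alpha$ and the normal connection forms $l_{\alpha\beta}$ are defined by $\widetilde\nabla_XN_\alpha=-A_\alpha X+\nabla^\bot_XN_\alpha$, $\nabla^\bot_XN_\alpha=\sum_\beta l_{\alpha\beta}(X)N_\beta$. The Nijenhuis tensor is $N_P(X,Y)=[PX,PY]+P^2[X,Y]-P[PX,Y]-P[X,PY]$, and the exterior derivative convention is $2du(X,Y)=X(u(Y))-Y(u(X))-u([X,Y])$. The induced structure is called normal if $N_P(X,Y)-2\sum_\alpha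 du_\alpha(X,Y)\xi_\alpha=0$ for all $X,Y\in\chi(M)$. $I_r$ is the $r\times r$ identity matrix. *)

theory Defs
  imports "HOL-Analysis.Analysis"
begin

text \<open>
  A smooth manifold is a Hausdorff, second countable type \<open>'m\<close> together with a smooth atlas with
  values in a Euclidean space \<open>'e\<close>, so its dimension is \<open>DIM('e)\<close>. All constructions below depend
  only on the smooth structure generated by the atlas, which need not be maximal.
\<close>

subsection \<open>Smooth manifolds\<close>

primrec Ck_on :: "nat \<Rightarrow> 'a::euclidean_space set \<Rightarrow> ('a \<Rightarrow> 'b::real_normed_vector) \<Rightarrow> bool" where
  "Ck_on 0 S f \<longleftrightarrow> continuous_on S f"
| "Ck_on (Suc k) S f \<longleftrightarrow>
     f differentiable_on S \<and> (\<forall>v. Ck_on k S (\<lambda>x. frechet_derivative f (at x) v))"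

text \<open>Only used for open \<open>S\<close>.\<close>

definition smooth_on :: "'a::euclidean_space set \<Rightarrow> ('a \<Rightarrow> 'b::real_normed_vector) \<Rightarrow> bool" where
  "smooth_on S f \<longleftrightarrow> (\<forall>k. Ck_on k S f)"

type_synonym ('m, 'e) chart = "'m set \<times> ('m \<Rightarrow> 'e)"
type_synonym ('m, 'e) atlas = "('m, 'e) chart set"

abbreviation cdom :: "('m, 'e) chart \<Rightarrow> 'm set" where "cdom c \<equiv> fst c"
abbreviation cmap :: "('m, 'e) chart \<Rightarrow> 'm \<Rightarrow> 'e" where "cmap c \<equiv> snd c"
abbreviation cinv :: "('m, 'e) chart \<Rightarrow> 'e \<Rightarrow> 'm" where "cinv c \<equiv> inv_into (cdom c) (cmap c)"

definition is_chart :: "('m::topological_space, 'e::euclidean_space) chart \<Rightarrow> bool" where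
  "is_chart c \<longleftrightarrow> open (cdom c) \<and> open (cmap c ` cdom c) \<and>
     homeomorphism (cdom c) (cmap c ` cdom c) (cmap c) (cinv c)"

definition smooth_manifold ::
  "('m::{t2_space,second_countable_topology}, 'e::euclidean_space) atlas \<Rightarrow> bool" where
  "smooth_manifold M \<longleftrightarrow> (\<forall>c\<in>M. is_chart c) \<and> (\<Union>c\<in>M. cdom c) = UNIV \<and>
     (\<forall>c\<in>M. \<forall>d\<in>M. smooth_on (cmap c ` (cdom c \<inter> cdom d)) (cmap d \<circ> cinv c))"

definition smooth_fun_on ::
  "('m::topological_space, 'e::euclidean_space) atlas \<Rightarrow> 'm set \<Rightarrow> ('m \<Rightarrow> real) \<Rightarrow> bool" where
  "smooth_fun_on M U h \<longleftrightarrow> (\<forall>c\<in>M. smooth_on (cmap c ` (cdom c \<inter> U)) (h \<circ> cinv c))"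

definition smooth_map ::
  "('m::topological_space, 'e::euclidean_space) atlas \<Rightarrow>
   ('b::topological_space, 'f::euclidean_space) atlas \<Rightarrow> ('m \<Rightarrow> 'b) \<Rightarrow> bool" where
  "smooth_map M N f \<longleftrightarrow> continuous_on UNIV f \<and>
     (\<forall>c\<in>M. \<forall>d\<in>N. smooth_on (cmap c ` (cdom c \<inter> f -` cdom d)) (cmap d \<circ> f \<circ> cinv c))"


subsection \<open>Tangent vectors and vector fields\<close>

text \<open>
  For each point \<open>p\<close> one chart \<open>chart_at M p\<close> around \<open>p\<close> is selected, and the tangent space at \<open>p\<close>
  is identified with \<open>'e\<close> through this chart: \<open>v :: 'e\<close> stands for the tangent vector at \<open>p\<close> whose
  components in \<open>chart_at M p\<close> are \<open>v\<close>. The components of the same tangent vector in another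
  chart \<open>c\<close> around \<open>p\<close> are \<open>tcoord M c p v\<close>. Hence a vector field is a function \<open>'m \<Rightarrow> 'e\<close>. Since
  \<open>chart_at\<close> varies arbitrarily with the point, such a function is never differentiated
  directly, only its components in a fixed chart are.
\<close>

definition chart_at :: "('m, 'e) atlas \<Rightarrow> 'm \<Rightarrow> ('m, 'e) chart" where
  "chart_at M p = (SOME c. c \<in> M \<and> p \<in> cdom c)"

text \<open>The differential at \<open>p\<close> of a function with values in a normed space, applied to the tangent
  vector \<open>v\<close>.\<close>

definition tderiv ::
  "('m, 'e::euclidean_space) atlas \<Rightarrow> 'm \<Rightarrow> ('m \<Rightarrow> 'v::real_normed_vector) \<Rightarrow> 'e \<Rightarrow> 'v" where
  "tderiv M p h v =
     frechet_derivative (h \<circ> cinv (chart_at M p)) (at (cmap (chart_at M p) p)) v"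

definition tcoord ::
  "('m, 'e::euclidean_space) atlas \<Rightarrow> ('m, 'e) chart \<Rightarrow> 'm \<Rightarrow> 'e \<Rightarrow> 'e" where
  "tcoord M c p v = tderiv M p (cmap c) v"

text \<open>The vector field on \<open>cdom c\<close> with constant components \<open>w\<close> in the chart \<open>c\<close>, that is,
  the linear combination of the coordinate fields of \<open>c\<close> with coefficients \<open>w\<close>.\<close>

definition coord_field ::
  "('m, 'e::euclidean_space) atlas \<Rightarrow> ('m, 'e) chart \<Rightarrow> 'e \<Rightarrow> 'm \<Rightarrow> 'e" where
  "coord_field M c w q = frechet_derivative (cmap (chart_at M q) \<circ> cinv c) (at (cmap c q)) w"

definition dmap ::
  "('m, 'e::euclidean_space) atlas \<Rightarrow> ('b, 'f::euclidean_space) atlas \<Rightarrow> ('m \<Rightarrow> 'b) \<Rightarrow>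
   'm \<Rightarrow> 'e \<Rightarrow> 'f" where
  "dmap M N f p v = tderiv M p (cmap (chart_at N (f p)) \<circ> f) v"

definition vector_field_on ::
  "('m::topological_space, 'e::euclidean_space) atlas \<Rightarrow> 'm set \<Rightarrow> ('m \<Rightarrow> 'e) \<Rightarrow> bool" where
  "vector_field_on M U X \<longleftrightarrow>
     (\<forall>c\<in>M. smooth_on (cmap c ` (cdom c \<inter> U)) ((\<lambda>q. tcoord M c q (X q)) \<circ> cinv c))"

abbreviation vector_field ::
  "('m::topological_space, 'e::euclidean_space) atlas \<Rightarrow> ('m \<Rightarrow> 'e) \<Rightarrow> bool" where
  "vector_field M X \<equiv> vector_field_on M UNIV X"

text \<open>Smooth sections of the pull-back of the tangent bundle of \<open>N\<close> under \<open>f\<close>.\<close>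

definition vector_field_along ::
  "('m::topological_space, 'e::euclidean_space) atlas \<Rightarrow>
   ('b::topological_space, 'f::euclidean_space) atlas \<Rightarrow> ('m \<Rightarrow> 'b) \<Rightarrow> ('m \<Rightarrow> 'f) \<Rightarrow> bool" where
  "vector_field_along M N f V \<longleftrightarrow>
     (\<forall>c\<in>M. \<forall>d\<in>N. smooth_on (cmap c ` (cdom c \<inter> f -` cdom d))
        ((\<lambda>q. tcoord N d (f q) (V q)) \<circ> cinv c))"

text \<open>In a chart, \<open>[X, Y] = DY(X) - DX(Y)\<close>; at \<open>p\<close> this is read off in \<open>chart_at M p\<close>.\<close>

definition lie_bracket ::
  "('m, 'e::euclidean_space) atlas \<Rightarrow> ('m \<Rightarrow> 'e) \<Rightarrow> ('m \<Rightarrow> 'e) \<Rightarrow> 'm \<Rightarrow> 'e" where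
  "lie_bracket M X Y p =
     tderiv M p (\<lambda>q. tcoord M (chart_at M p) q (Y q)) (X p)
     - tderiv M p (\<lambda>q. tcoord M (chart_at M p) q (X q)) (Y p)"

definition tensor11 ::
  "('m::topological_space, 'e::euclidean_space) atlas \<Rightarrow> ('m \<Rightarrow> 'e \<Rightarrow> 'e) \<Rightarrow> bool" where
  "tensor11 M P \<longleftrightarrow> (\<forall>p. linear (P p)) \<and>
     (\<forall>U X. open U \<longrightarrow> vector_field_on M U X \<longrightarrow> vector_field_on M U (\<lambda>p. P p (X p)))"

definition one_form ::
  "('m::topological_space, 'e::euclidean_space) atlas \<Rightarrow> ('m \<Rightarrow> 'e \<Rightarrow> real) \<Rightarrow> bool" where
  "one_form M u \<longleftrightarrow> (\<forall>p. linear (u p)) \<and>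
     (\<forall>U X. open U \<longrightarrow> vector_field_on M U X \<longrightarrow> smooth_fun_on M U (\<lambda>p. u p (X p)))"

text \<open>Convention: \<open>2 du(X, Y) = X(u(Y)) - Y(u(X)) - u([X, Y])\<close>.\<close>

definition ext_deriv ::
  "('m, 'e::euclidean_space) atlas \<Rightarrow> ('m \<Rightarrow> 'e \<Rightarrow> real) \<Rightarrow> ('m \<Rightarrow> 'e) \<Rightarrow> ('m \<Rightarrow> 'e) \<Rightarrow> 'm \<Rightarrow> real" where
  "ext_deriv M u X Y p =
     (tderiv M p (\<lambda>q. u q (Y q)) (X p) - tderiv M p (\<lambda>q. u q (X q)) (Y p)
      - u p (lie_bracket M X Y p)) / 2"

definition nijenhuis ::
  "('m, 'e::euclidean_space) atlas \<Rightarrow> ('m \<Rightarrow> 'e \<Rightarrow> 'e) \<Rightarrow> ('m \<Rightarrow> 'e) \<Rightarrow> ('m \<Rightarrow> 'e) \<Rightarrow> 'm \<Rightarrow> 'e" where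
  "nijenhuis M P X Y p =
     lie_bracket M (\<lambda>q. P q (X q)) (\<lambda>q. P q (Y q)) p
     + P p (P p (lie_bracket M X Y p))
     - P p (lie_bracket M (\<lambda>q. P q (X q)) Y p)
     - P p (lie_bracket M X (\<lambda>q. P q (Y q)) p)"


subsection \<open>Riemannian metrics and connections\<close>

definition riemannian_metric ::
  "('m::topological_space, 'e::euclidean_space) atlas \<Rightarrow> ('m \<Rightarrow> 'e \<Rightarrow> 'e \<Rightarrow> real) \<Rightarrow> bool" where
  "riemannian_metric M g \<longleftrightarrow>
     (\<forall>p. bilinear (g p) \<and> (\<forall>v w. g p v w = g p w v) \<and> (\<forall>v. v \<noteq> 0 \<longrightarrow> g p v v > 0)) \<and>
     (\<forall>U X Y. open U \<longrightarrow> vector_field_on M U X \<longrightarrow> vector_field_on M U Y \<longrightarrow>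
        smooth_fun_on M U (\<lambda>p. g p (X p) (Y p)))"

text \<open>
  \<open>D p v Y\<close> is the covariant derivative at \<open>p\<close> in the direction of the tangent vector \<open>v\<close> of a
  vector field \<open>Y\<close> that is smooth on some neighbourhood of \<open>p\<close>. Values of \<open>D\<close> on other functions
  \<open>Y\<close> are unspecified. That \<open>D p v Y\<close> depends only on the germ of \<open>Y\<close> at \<open>p\<close> follows from the
  Leibniz rule, as \<open>h\<close> need only be smooth near \<open>p\<close>.
\<close>

definition affine_connection ::
  "('m::topological_space, 'e::euclidean_space) atlas \<Rightarrow> ('m \<Rightarrow> 'e \<Rightarrow> ('m \<Rightarrow> 'e) \<Rightarrow> 'e) \<Rightarrow> bool" where
  "affine_connection M D \<longleftrightarrow>
     (\<forall>U Y. open U \<longrightarrow> vector_field_on M U Y \<longrightarrow>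
        (\<forall>p\<in>U. linear (\<lambda>v. D p v Y)) \<and>
        (\<forall>Z. vector_field_on M U Z \<longrightarrow>
           (\<forall>p\<in>U. \<forall>v. D p v (\<lambda>q. Y q + Z q) = D p v Y + D p v Z)) \<and>
        (\<forall>h. smooth_fun_on M U h \<longrightarrow>
           (\<forall>p\<in>U. \<forall>v. D p v (\<lambda>q. h q *\<^sub>R Y q) = tderiv M p h v *\<^sub>R Y p + h p *\<^sub>R D p v Y)) \<and>
        (\<forall>X. vector_field_on M U X \<longrightarrow> vector_field_on M U (\<lambda>p. D p (X p) Y)))"

definition levi_civita ::
  "('m::topological_space, 'e::euclidean_space) atlas \<Rightarrow> ('m \<Rightarrow> 'e \<Rightarrow> 'e \<Rightarrow> real) \<Rightarrow>
   ('m \<Rightarrow> 'e \<Rightarrow> ('m \<Rightarrow> 'e) \<Rightarrow> 'e) \<Rightarrow> bool" where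
  "levi_civita M g D \<longleftrightarrow> affine_connection M D \<and>
     (\<forall>U X Y. open U \<longrightarrow> vector_field_on M U X \<longrightarrow> vector_field_on M U Y \<longrightarrow>
        (\<forall>p\<in>U. D p (X p) Y - D p (Y p) X = lie_bracket M X Y p)) \<and>
     (\<forall>U Y Z. open U \<longrightarrow> vector_field_on M U Y \<longrightarrow> vector_field_on M U Z \<longrightarrow>
        (\<forall>p\<in>U. \<forall>v. tderiv M p (\<lambda>q. g q (Y q) (Z q)) v = g p (D p v Y) (Z p) + g p (Y p) (D p v Z)))"

text \<open>
  The connection \<open>D\<close> of \<open>N\<close> applied to a vector field \<open>V\<close> along \<open>f\<close> (the pull-back connection). In
  the chart \<open>c\<close> selected at \<open>f p\<close>, with coordinate fields \<open>E\<^sub>i\<close> and \<open>V = (\<Sum>i. V\<^sub>i E\<^sub>i)\<close> near \<open>p\<close>, it is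
  \<open>(\<Sum>i. dV\<^sub>i(v) E\<^sub>i + V\<^sub>i(p) D(df(v), E\<^sub>i))\<close>. If \<open>V = W \<circ> f\<close> near \<open>p\<close> for a vector field \<open>W\<close> on \<open>N\<close>,
  this is \<open>D (f p) (dmap M N f p v) W\<close>.
\<close>

definition cov_deriv_along ::
  "('m, 'e::euclidean_space) atlas \<Rightarrow> ('b, 'f::euclidean_space) atlas \<Rightarrow> ('m \<Rightarrow> 'b) \<Rightarrow>
   ('b \<Rightarrow> 'f \<Rightarrow> ('b \<Rightarrow> 'f) \<Rightarrow> 'f) \<Rightarrow> 'm \<Rightarrow> 'e \<Rightarrow> ('m \<Rightarrow> 'f) \<Rightarrow> 'f" where
  "cov_deriv_along M N f D p v V =
     (let c = chart_at N (f p) in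
        tderiv M p (\<lambda>q. tcoord N c (f q) (V q)) v
        + D (f p) (dmap M N f p v) (coord_field N c (V p)))"


subsection \<open>Product structures and submanifolds\<close>

definition almost_product_riemannian ::
  "('m::topological_space, 'e::euclidean_space) atlas \<Rightarrow> ('m \<Rightarrow> 'e \<Rightarrow> 'e \<Rightarrow> real) \<Rightarrow>
   ('m \<Rightarrow> 'e \<Rightarrow> 'e) \<Rightarrow> bool" where
  "almost_product_riemannian M g P \<longleftrightarrow> riemannian_metric M g \<and> tensor11 M P \<and>
     (\<forall>p v. P p (P p v) = v) \<and> (\<forall>p v w. g p (P p v) (P p w) = g p v w)"

text \<open>The last clause is \<open>\<nabla>P = 0\<close>, with \<open>\<nabla> = D\<close> the Levi-Civita connection.\<close>

definition locally_product_riemannian ::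
  "('m::topological_space, 'e::euclidean_space) atlas \<Rightarrow> ('m \<Rightarrow> 'e \<Rightarrow> 'e \<Rightarrow> real) \<Rightarrow>
   ('m \<Rightarrow> 'e \<Rightarrow> ('m \<Rightarrow> 'e) \<Rightarrow> 'e) \<Rightarrow> ('m \<Rightarrow> 'e \<Rightarrow> 'e) \<Rightarrow> bool" where
  "locally_product_riemannian M g D P \<longleftrightarrow>
     almost_product_riemannian M g P \<and> levi_civita M g D \<and>
     (\<forall>U Y. open U \<longrightarrow> vector_field_on M U Y \<longrightarrow>
        (\<forall>p\<in>U. \<forall>v. D p v (\<lambda>q. P q (Y q)) - P p (D p v Y) = 0))"

definition isometric_immersion ::
  "('m::topological_space, 'e::euclidean_space) atlas \<Rightarrow> ('m \<Rightarrow> 'e \<Rightarrow> 'e \<Rightarrow> real) \<Rightarrow>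
   ('b::topological_space, 'f::euclidean_space) atlas \<Rightarrow> ('b \<Rightarrow> 'f \<Rightarrow> 'f \<Rightarrow> real) \<Rightarrow>
   ('m \<Rightarrow> 'b) \<Rightarrow> bool" where
  "isometric_immersion M g N gt f \<longleftrightarrow> smooth_map M N f \<and> (\<forall>p. inj (dmap M N f p)) \<and>
     riemannian_metric M g \<and>
     (\<forall>p v w. g p v w = gt (f p) (dmap M N f p v) (dmap M N f p w))"

text \<open>When the codimension is \<open>CARD('r)\<close>, such a family is an orthonormal frame of the normal
  bundle.\<close>

definition orthonormal_normal_frame ::
  "('m::topological_space, 'e::euclidean_space) atlas \<Rightarrow>
   ('b::topological_space, 'f::euclidean_space) atlas \<Rightarrow> ('b \<Rightarrow> 'f \<Rightarrow> 'f \<Rightarrow> real) \<Rightarrow>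
   ('m \<Rightarrow> 'b) \<Rightarrow> ('r \<Rightarrow> 'm \<Rightarrow> 'f) \<Rightarrow> bool" where
  "orthonormal_normal_frame M N gt f nu \<longleftrightarrow>
     (\<forall>\<alpha>. vector_field_along M N f (nu \<alpha>)) \<and>
     (\<forall>\<alpha> p v. gt (f p) (nu \<alpha> p) (dmap M N f p v) = 0) \<and>
     (\<forall>\<alpha> \<beta> p. gt (f p) (nu \<alpha> p) (nu \<beta> p) = (if \<alpha> = \<beta> then 1 else 0))"

definition induced_structure ::
  "('m::topological_space, 'e::euclidean_space) atlas \<Rightarrow>
   ('b::topological_space, 'f::euclidean_space) atlas \<Rightarrow> ('b \<Rightarrow> 'f \<Rightarrow> 'f) \<Rightarrow>
   ('m \<Rightarrow> 'b) \<Rightarrow> ('r::finite \<Rightarrow> 'm \<Rightarrow> 'f) \<Rightarrow>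
   ('m \<Rightarrow> 'e \<Rightarrow> 'e) \<Rightarrow> ('r \<Rightarrow> 'm \<Rightarrow> 'e \<Rightarrow> real) \<Rightarrow> ('r \<Rightarrow> 'm \<Rightarrow> 'e) \<Rightarrow> ('m \<Rightarrow> real^'r^'r) \<Rightarrow> bool" where
  "induced_structure M N Pt f nu P u \<xi> a \<longleftrightarrow>
     tensor11 M P \<and> (\<forall>\<alpha>. one_form M (u \<alpha>)) \<and> (\<forall>\<alpha>. vector_field M (\<xi> \<alpha>)) \<and>
     (\<forall>\<alpha> \<beta>. smooth_fun_on M UNIV (\<lambda>p. a p $ \<alpha> $ \<beta>)) \<and>
     (\<forall>p v. Pt (f p) (dmap M N f p v) =
        dmap M N f p (P p v) + (\<Sum>\<alpha>\<in>UNIV. u \<alpha> p v *\<^sub>R nu \<alpha> p)) \<and>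
     (\<forall>\<alpha> p. Pt (f p) (nu \<alpha> p) =
        dmap M N f p (\<xi> \<alpha> p) + (\<Sum>\<beta>\<in>UNIV. (a p $ \<alpha> $ \<beta>) *\<^sub>R nu \<beta> p))"

text \<open>The Weingarten operators \<open>A \<alpha>\<close> and the normal connection forms \<open>l \<alpha> \<beta>\<close>.\<close>

definition weingarten ::
  "('m, 'e::euclidean_space) atlas \<Rightarrow> ('b, 'f::euclidean_space) atlas \<Rightarrow>
   ('b \<Rightarrow> 'f \<Rightarrow> ('b \<Rightarrow> 'f) \<Rightarrow> 'f) \<Rightarrow> ('m \<Rightarrow> 'b) \<Rightarrow> ('r::finite \<Rightarrow> 'm \<Rightarrow> 'f) \<Rightarrow>
   ('r \<Rightarrow> 'm \<Rightarrow> 'e \<Rightarrow> 'e) \<Rightarrow> ('r \<Rightarrow> 'r \<Rightarrow> 'm \<Rightarrow> 'e \<Rightarrow> real) \<Rightarrow> bool" where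
  "weingarten M N D f nu A l \<longleftrightarrow>
     (\<forall>\<alpha> p v. cov_deriv_along M N f D p v (nu \<alpha>) =
        - dmap M N f p (A \<alpha> p v) + (\<Sum>\<beta>\<in>UNIV. l \<alpha> \<beta> p v *\<^sub>R nu \<beta> p))"

definition normal_structure ::
  "('m::topological_space, 'e::euclidean_space) atlas \<Rightarrow> ('m \<Rightarrow> 'e \<Rightarrow> 'e) \<Rightarrow>
   ('r::finite \<Rightarrow> 'm \<Rightarrow> 'e \<Rightarrow> real) \<Rightarrow> ('r \<Rightarrow> 'm \<Rightarrow> 'e) \<Rightarrow> bool" where
  "normal_structure M P u \<xi> \<longleftrightarrow>
     (\<forall>X Y. vector_field M X \<longrightarrow> vector_field M Y \<longrightarrow>
        (\<forall>p. nijenhuis M P X Y p - 2 *\<^sub>R (\<Sum>\<alpha>\<in>UNIV. ext_deriv M (u \<alpha>) X Y p *\<^sub>R \<xi> \<alpha> p) = 0))"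

end

theory Submission
  imports Defs
begin

text \<open>
  Write \<open>J\<close> for the product structure of the ambient manifold, \<open>D\<close> for its Levi-Civita connection
  pulled back along the immersion \<open>f\<close>, and \<open>B\<^sub>\<alpha> = P A\<^sub>\<alpha> - A\<^sub>\<alpha> P\<close>. No connection on \<open>M\<close> is needed:
  the brackets in the Nijenhuis tensor are computed from \<open>df [X, Y] = D\<^sub>X (df Y) - D\<^sub>Y (df X)\<close>,
  \<open>D J = J D\<close> and \<open>D\<^sub>X N\<^sub>\<alpha> = - df (A\<^sub>\<alpha> X)\<close>. The tangential part gives that the tensor whose vanishing
  is normality equals \<open>S(X, Y) = (\<Sum>\<alpha>. u\<^sub>\<alpha>(X) B\<^sub>\<alpha> Y - u\<^sub>\<alpha>(Y) B\<^sub>\<alpha> X)\<close>.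

  Conversely let \<open>S = 0\<close>. Bump functions extend every tangent vector to a global field, so \<open>S\<close> vanishes
  pointwise. As \<open>u\<^sub>\<alpha>(\<xi>\<^sub>\<beta>)\<close> are the entries of the invertible matrix \<open>I - a\<^sup>2\<close>, there are vectors \<open>e\<^sub>\<beta>\<close>
  with \<open>u\<^sub>\<alpha>(e\<^sub>\<beta>) = \<delta>\<^sub>\<alpha>\<^sub>\<beta>\<close>, and \<open>S(X, e\<^sub>\<beta>) = 0\<close> reads \<open>B\<^sub>\<beta> X = (\<Sum>\<alpha>. u\<^sub>\<alpha>(X) B\<^sub>\<alpha> e\<^sub>\<beta>)\<close>. Each \<open>B\<^sub>\<beta>\<close> is
  skew-symmetric, so \<open>g(B\<^sub>\<alpha> e\<^sub>\<beta>, e\<^sub>\<gamma>)\<close> is symmetric in \<open>\<alpha>, \<beta>\<close> and alternating in \<open>\<beta>, \<gamma>\<close>, hence zero,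
  and from this all \<open>B\<^sub>\<beta>\<close> vanish.
\<close>

subsection \<open>Calculus of smooth functions\<close>

text \<open>Functions that agree near \<open>x\<close> have the same derivatives there, so the
  Hilbert choice behind \<open>frechet_derivative\<close> picks the same map, even at points where
  no derivative exists.\<close>

lemma frechet_derivative_cong_open:
  assumes "open S" "x \<in> S" "\<And>y. y \<in> S \<Longrightarrow> f y = g y"
  shows "frechet_derivative f (at x) = frechet_derivative g (at x)"
proof -
  have "(f has_derivative D) (at x) \<longleftrightarrow> (g has_derivative D) (at x)" for D
    using has_derivative_transform_within_open[OF _ assms(1,2), of f D UNIV g]
      has_derivative_transform_within_open[OF _ assms(1,2), of g D UNIV f] assms(3) by auto
  then show ?thesis unfolding frechet_derivative_def by simp
qed

lemma frechet_derivative_works_at: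
  "f differentiable (at x) \<Longrightarrow> (f has_derivative frechet_derivative f (at x)) (at x)"
  by (simp add: frechet_derivative_works[symmetric])

lemma frechet_derivative_eqI:
  "(f has_derivative D) (at x) \<Longrightarrow> frechet_derivative f (at x) v = D v"
  by (simp add: frechet_derivative_at[symmetric])

lemma differentiable_on_open_cong:
  assumes "open S" "\<And>x. x \<in> S \<Longrightarrow> f x = g x"
  shows "f differentiable_on S \<longleftrightarrow> g differentiable_on S"
  using differentiable_transform_within[of f _ S 1 g]
    differentiable_transform_within[of g _ S 1 f] assms(2)
  unfolding differentiable_on_def by (metis zero_less_one)

section \<open>Closure properties of finitely often differentiable maps\<close>

lemma Ck_on_cong:
  assumes "open S" "\<And>x. x \<in> S \<Longrightarrow> f x = g x"
  shows "Ck_on k S f \<longleftrightarrow> Ck_on k S g"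
  using assms(2)
proof (induction k arbitrary: f g)
  case 0
  then show ?case by (simp cong: continuous_on_cong)
next
  case (Suc k)
  have "frechet_derivative f (at x) v = frechet_derivative g (at x) v" if "x \<in> S" for x v
    using frechet_derivative_cong_open[OF assms(1) that, of f g] Suc.prems by simp
  then have "Ck_on k S (\<lambda>x. frechet_derivative f (at x) v) \<longleftrightarrow>
      Ck_on k S (\<lambda>x. frechet_derivative g (at x) v)" for v
    by (intro Suc.IH) auto
  then show ?case using differentiable_on_open_cong[OF assms(1) Suc.prems] by simp
qed

lemma Ck_on_subset: "Ck_on k S f \<Longrightarrow> T \<subseteq> S \<Longrightarrow> Ck_on k T f"
proof (induction k arbitrary: f)
  case 0
  then show ?case using continuous_on_subset by (metis Ck_on.simps(1))
next
  case (Suc k)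
  then show ?case using differentiable_on_subset by (metis Ck_on.simps(2))
qed

lemma Ck_on_SucD: "Ck_on (Suc k) S f \<Longrightarrow> Ck_on k S f"
proof (induction k arbitrary: f)
  case 0
  then show ?case using differentiable_imp_continuous_on by auto
next
  case (Suc k)
  then show ?case by (metis Ck_on.simps(2))
qed

text \<open>Differentiability is local on open sets. This later glues the two pieces of a vector
  field that is extended by zero.\<close>

lemma Ck_on_Un:
  assumes "open S" "open T" "Ck_on k S f" "Ck_on k T f"
  shows "Ck_on k (S \<union> T) f"
  using assms(3,4)
proof (induction k arbitrary: f)
  case 0
  then show ?case using assms(1,2) by (simp add: continuous_on_open_Un)
next
  case (Suc k)
  have "f differentiable_on (S \<union> T)"
    using Suc.prems assms(1,2)
    by (auto simp: differentiable_on_eq_differentiable_at open_Un)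
  then show ?case using Suc by auto
qed

lemma Ck_on_const: "Ck_on k S (\<lambda>x. c)"
  by (induction k arbitrary: c) auto

lemma Ck_on_bounded_linear:
  assumes "bounded_linear L"
  shows "Ck_on k S L"
proof (cases k)
  case 0
  then show ?thesis using assms linear_continuous_on by auto
next
  case (Suc j)
  have "frechet_derivative L (at x) = L" for x
    using bounded_linear.has_derivative[OF assms has_derivative_ident] frechet_derivative_at by metis
  then show ?thesis
    using assms Suc by (simp add: Ck_on_const bounded_linear_imp_differentiable_on)
qed

lemma Ck_on_add:
  assumes "open S" "Ck_on k S f" "Ck_on k S g"
  shows "Ck_on k S (\<lambda>x. f x + g x)"
  using assms(2,3)
proof (induction k arbitrary: f g)
  case 0
  then show ?case by (auto intro: continuous_on_add)
next
  case (Suc k)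
  have *: "f differentiable at x" "g differentiable at x" if "x \<in> S" for x
    using Suc.prems that assms(1) by (auto simp: differentiable_on_eq_differentiable_at)
  have "frechet_derivative (\<lambda>x. f x + g x) (at x) v =
      frechet_derivative f (at x) v + frechet_derivative g (at x) v" if "x \<in> S" for x v
    by (intro frechet_derivative_eqI has_derivative_add frechet_derivative_works_at * that)
  then have "Ck_on k S (\<lambda>x. frechet_derivative (\<lambda>x. f x + g x) (at x) v)" for v
    using Suc by (subst Ck_on_cong[OF assms(1)]) (auto intro!: Suc.IH)
  then show ?case using Suc.prems by (auto intro: differentiable_on_add)
qed

lemma Ck_on_sum:
  assumes "open S" "\<And>i. i \<in> I \<Longrightarrow> Ck_on k S (f i)"
  shows "Ck_on k S (\<lambda>x. \<Sum>i\<in>I. f i x)"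
  using assms(2) by (induction I rule: infinite_finite_induct) (simp_all add: Ck_on_const Ck_on_add assms(1))

text \<open>One product rule for multiplication, scaling and inner products. By the Leibniz formula
  the derivative is again a sum of such products, with all factors of class
  \<open>k\<close>.\<close>

lemma Ck_on_bilinear:
  assumes "bounded_bilinear B" "open S" "Ck_on k S f" "Ck_on k S g"
  shows "Ck_on k S (\<lambda>x. B (f x) (g x))"
  using assms(3,4)
proof (induction k arbitrary: f g)
  case 0
  then show ?case using bounded_bilinear.continuous_on[OF assms(1)] by auto
next
  case (Suc k)
  have *: "f differentiable at x" "g differentiable at x" if "x \<in> S" for x
    using Suc.prems that assms(2) by (auto simp: differentiable_on_eq_differentiable_at)
  have h: "((\<lambda>x. B (f x) (g x)) has_derivative
      (\<lambda>v. B (f x) (frechet_derivative g (at x) v) + B (frechet_derivative f (at x) v) (g x))) (at x)"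
    if "x \<in> S" for x
    by (intro bounded_bilinear.FDERIV[OF assms(1)] frechet_derivative_works_at * that)
  have "Ck_on k S (\<lambda>x. frechet_derivative (\<lambda>x. B (f x) (g x)) (at x) v)" for v
    using Suc.prems
    by (subst Ck_on_cong[OF assms(2) frechet_derivative_eqI[OF h]])
      (auto intro!: Ck_on_add assms(2) Suc.IH intro: Ck_on_SucD simp del: Ck_on.simps(2), auto)
  moreover have "(\<lambda>x. B (f x) (g x)) differentiable_on S"
    using h assms(2) by (auto simp: differentiable_on_eq_differentiable_at differentiable_def)
  ultimately show ?case by simp
qed

text \<open>The chain rule gives a linear map evaluated at a vector, both varying with the point.
  Expanding the vector in \<open>Basis\<close> separates them into components of the derivative of
  \<open>f\<close> and directional derivatives of \<open>g\<close> composed with \<open>f\<close>.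
  The latter fall under the induction hypothesis, so \<open>g\<close> is arbitrary while
  \<open>f\<close> is fixed.\<close>

lemma Ck_on_compose:
  fixes f :: "'a::euclidean_space \<Rightarrow> 'b::euclidean_space" and g :: "'b \<Rightarrow> 'c::real_normed_vector"
  assumes "open S" "open T" "f ` S \<subseteq> T" "Ck_on k S f" "Ck_on k T g"
  shows "Ck_on k S (g \<circ> f)"
  using assms(4,5)
proof (induction k arbitrary: g)
  case 0
  then show ?case using assms(3) continuous_on_compose continuous_on_subset
    by (metis Ck_on.simps(1))
next
  case (Suc k)
  have f: "(f has_derivative frechet_derivative f (at x)) (at x)" if "x \<in> S" for x
    using Suc.prems that assms(1)
    by (auto simp: differentiable_on_eq_differentiable_at intro: frechet_derivative_works_at)
  have g: "(g has_derivative frechet_derivative g (at y)) (at y)" if "y \<in> T" for y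
    using Suc.prems that assms(2)
    by (auto simp: differentiable_on_eq_differentiable_at intro: frechet_derivative_works_at)
  have d: "(g \<circ> f has_derivative frechet_derivative g (at (f x)) \<circ> frechet_derivative f (at x)) (at x)"
    if "x \<in> S" for x
    using diff_chain_at[OF f g] that assms(3) by blast
  have eq: "frechet_derivative (g \<circ> f) (at x) v =
      (\<Sum>b\<in>Basis. (frechet_derivative f (at x) v \<bullet> b) *\<^sub>R ((\<lambda>y. frechet_derivative g (at y) b) \<circ> f) x)"
    if "x \<in> S" for x v
  proof -
    have "linear (frechet_derivative g (at (f x)))"
      using has_derivative_linear[OF g] that assms(3) by blast
    then have "frechet_derivative g (at (f x)) (\<Sum>b\<in>Basis. (frechet_derivative f (at x) v \<bullet> b) *\<^sub>R b)
      = (\<Sum>b\<in>Basis. (frechet_derivative f (at x) v \<bullet> b) *\<^sub>R frechet_derivative g (at (f x)) b)"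
      by (simp add: linear_sum linear_scale)
    then show ?thesis using frechet_derivative_eqI[OF d[OF that]] by (simp add: euclidean_representation)
  qed
  have "Ck_on k S (\<lambda>x. frechet_derivative (g \<circ> f) (at x) v)" for v
  proof (subst Ck_on_cong[OF assms(1) eq])
    have "Ck_on k S ((\<lambda>y. frechet_derivative g (at y) b) \<circ> f)" for b
      using Suc.prems by (intro Suc.IH Ck_on_SucD[OF Suc.prems(1)]) simp
    moreover have "Ck_on k S (\<lambda>x. frechet_derivative f (at x) v \<bullet> b)" for b
      using Suc.prems
      by (intro Ck_on_bilinear[OF bounded_bilinear_inner assms(1)] Ck_on_const) simp
    ultimately show "Ck_on k S (\<lambda>x. \<Sum>b\<in>Basis. (frechet_derivative f (at x) v \<bullet> b) *\<^sub>R
        ((\<lambda>y. frechet_derivative g (at y) b) \<circ> f) x)"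
      by (intro Ck_on_sum Ck_on_bilinear[OF bounded_bilinear_scaleR] assms(1))
  qed
  moreover have "(g \<circ> f) differentiable_on S"
    using d assms(1) by (auto simp: differentiable_on_eq_differentiable_at differentiable_def)
  ultimately show ?case by (simp del: o_apply add: o_def[symmetric])
qed

section \<open>Smooth maps on Euclidean spaces\<close>

lemma smooth_on_cong: "open S \<Longrightarrow> (\<And>x. x \<in> S \<Longrightarrow> f x = g x) \<Longrightarrow> smooth_on S f \<longleftrightarrow> smooth_on S g"
  by (simp add: smooth_on_def Ck_on_cong[of S f g])

lemma smooth_on_subset: "smooth_on S f \<Longrightarrow> T \<subseteq> S \<Longrightarrow> smooth_on T f"
  by (auto simp: smooth_on_def dest: Ck_on_subset)

lemma smooth_on_Un:
  "open S \<Longrightarrow> open T \<Longrightarrow> smooth_on S f \<Longrightarrow> smooth_on T f \<Longrightarrow> smooth_on (S \<union> T) f"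
  by (simp add: smooth_on_def Ck_on_Un)

lemma smooth_on_const: "smooth_on S (\<lambda>x. c)"
  by (simp add: smooth_on_def Ck_on_const)

lemma smooth_on_bounded_linear: "bounded_linear L \<Longrightarrow> smooth_on S L"
  by (simp add: smooth_on_def Ck_on_bounded_linear)

lemma smooth_on_add:
  "open S \<Longrightarrow> smooth_on S f \<Longrightarrow> smooth_on S g \<Longrightarrow> smooth_on S (\<lambda>x. f x + g x)"
  by (simp add: smooth_on_def Ck_on_add)

lemma smooth_on_bilinear:
  "bounded_bilinear B \<Longrightarrow> open S \<Longrightarrow> smooth_on S f \<Longrightarrow> smooth_on S g \<Longrightarrow>
   smooth_on S (\<lambda>x. B (f x) (g x))"
  by (simp add: smooth_on_def Ck_on_bilinear)

lemma smooth_on_compose: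
  fixes f :: "'a::euclidean_space \<Rightarrow> 'b::euclidean_space" and g :: "'b \<Rightarrow> 'c::real_normed_vector"
  assumes "open S" "open T" "f ` S \<subseteq> T" "smooth_on S f" "smooth_on T g"
  shows "smooth_on S (g \<circ> f)"
  using assms Ck_on_compose[OF assms(1-3), of _ g] by (auto simp add: smooth_on_def simp del: o_apply)

lemma smooth_on_frechet_derivative:
  "smooth_on S f \<Longrightarrow> smooth_on S (\<lambda>x. frechet_derivative f (at x) v)"
  unfolding smooth_on_def by (metis Ck_on.simps(2))

lemma smooth_on_imp_continuous_on: "smooth_on S f \<Longrightarrow> continuous_on S f"
  unfolding smooth_on_def by (metis Ck_on.simps(1))

lemma smooth_on_imp_has_derivative:
  assumes "smooth_on S f" "open S" "x \<in> S"
  shows "(f has_derivative frechet_derivative f (at x)) (at x)"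
proof -
  have "Ck_on (Suc 0) S f" using assms unfolding smooth_on_def by blast
  then show ?thesis
    using assms by (auto simp: differentiable_on_eq_differentiable_at intro: frechet_derivative_works_at)
qed

text \<open>Schwarz's theorem, needed to cancel the second derivatives of the immersion when
  brackets are pushed forward. Components are treated one at a time because the mean value theorem
  concerns real-valued functions.\<close>

lemma frechet_derivative_symmetric:
  fixes F :: "'a::euclidean_space \<Rightarrow> 'b::euclidean_space"
  assumes "smooth_on S F" "open S" "x \<in> S"
  shows "frechet_derivative (\<lambda>y. frechet_derivative F (at y) w) (at x) v =
    frechet_derivative (\<lambda>y. frechet_derivative F (at y) v) (at x) w"
proof (rule euclidean_eqI)
  fix b :: 'b assume "b \<in> Basis"
  define D2 where "D2 v w y = frechet_derivative (\<lambda>y. frechet_derivative F (at y) w) (at y) v \<bullet> b"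
    for v w y
  have F1: "(F has_derivative frechet_derivative F (at y)) (at y)" if "y \<in> S" for y
    using assms(1,2) that by (rule smooth_on_imp_has_derivative)
  have F2: "((\<lambda>y. frechet_derivative F (at y) w) has_derivative
     frechet_derivative (\<lambda>y. frechet_derivative F (at y) w) (at y)) (at y)" if "y \<in> S" for y w
    using smooth_on_frechet_derivative[OF assms(1)] assms(2) that by (rule smooth_on_imp_has_derivative)
  have cont: "continuous_on S (D2 v w)" for v w
    unfolding D2_def
    by (intro continuous_intros smooth_on_imp_continuous_on smooth_on_frechet_derivative assms)
  obtain r where r: "r > 0" "ball x r \<subseteq> S" using assms openE by blast
  \<comment> \<open>The parallelogram at \<open>x\<close> with sides \<open>h *\<^sub>R v\<close>
    and \<open>h *\<^sub>R w\<close> stays within distance \<open>h * K\<close>; the summand 1 keeps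
    \<open>K\<close> positive when both vectors vanish.\<close>
  define K where "K = norm v + norm w + 1"
  have K: "K > 0" unfolding K_def by (smt (verit) norm_ge_zero)
  have inb: "x + s *\<^sub>R v + t *\<^sub>R w \<in> ball x e"
    if "0 \<le> s" "s \<le> h" "0 \<le> t" "t \<le> h" "h * K < e" "0 < h" for s t h e
  proof -
    have "norm (s *\<^sub>R v + t *\<^sub>R w) \<le> s * norm v + t * norm w"
      using norm_triangle_ineq[of "s *\<^sub>R v" "t *\<^sub>R w"] that by simp
    also have "\<dots> \<le> h * norm v + h * norm w"
      by (intro add_mono mult_right_mono that norm_ge_zero)
    also have "\<dots> < e" using that by (simp add: K_def algebra_simps)
    finally have "dist (x + (s *\<^sub>R v + t *\<^sub>R w)) x < e" by (simp add: dist_norm)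
    then show ?thesis by (simp add: dist_commute add.assoc)
  qed
  \<comment> \<open>The second difference of \<open>F\<close> over a parallelogram equals \<open>h\<^sup>2\<close> times either
    mixed derivative at some point of it, by applying the mean value theorem twice.\<close>
  have mvt: "\<exists>s t. 0 \<le> s \<and> s \<le> h \<and> 0 \<le> t \<and> t \<le> h \<and>
      F (x + h *\<^sub>R v' + h *\<^sub>R w') \<bullet> b - F (x + h *\<^sub>R v') \<bullet> b - F (x + h *\<^sub>R w') \<bullet> b + F x \<bullet> b
        = h * h * D2 w' v' (x + s *\<^sub>R v' + t *\<^sub>R w')"
    if h: "0 < h" "\<And>s t. \<lbrakk>0 \<le> s; s \<le> h; 0 \<le> t; t \<le> h\<rbrakk> \<Longrightarrow> x + s *\<^sub>R v' + t *\<^sub>R w' \<in> S"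
    for h v' w'
  proof -
    define \<phi> where "\<phi> s = F (x + s *\<^sub>R v' + h *\<^sub>R w') \<bullet> b - F (x + s *\<^sub>R v') \<bullet> b" for s
    have d1: "((\<lambda>s. F (x + s *\<^sub>R v' + t *\<^sub>R w') \<bullet> b) has_real_derivative
        frechet_derivative F (at (x + s *\<^sub>R v' + t *\<^sub>R w')) v' \<bullet> b) (at s)"
      if "0 \<le> s" "s \<le> h" "0 \<le> t" "t \<le> h" for s t
    proof -
      let ?y = "x + s *\<^sub>R v' + t *\<^sub>R w'"
      have "((\<lambda>s. x + s *\<^sub>R v' + t *\<^sub>R w') has_derivative (\<lambda>s. s *\<^sub>R v')) (at s)"
        by (auto intro!: derivative_eq_intros)
      from has_derivative_compose[OF this F1[OF h(2)[OF that]]]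
      have "((\<lambda>s. F (x + s *\<^sub>R v' + t *\<^sub>R w') \<bullet> b) has_derivative
          (\<lambda>s. frechet_derivative F (at ?y) (s *\<^sub>R v') \<bullet> b)) (at s)"
        by (intro derivative_intros) auto
      then show ?thesis unfolding has_field_derivative_def
        by (rule has_derivative_eq_rhs)
          (simp add: linear_scale[OF has_derivative_linear[OF F1[OF h(2)[OF that]]]] fun_eq_iff)
    qed
    \<comment> \<open>The summand \<open>0 *\<^sub>R w'\<close> presents \<open>\<phi>' s\<close> as
      the difference of the values at \<open>h\<close> and at 0 of one function of \<open>t\<close>,
      ready for the second mean value theorem.\<close>
    define \<phi>' where "\<phi>' s = frechet_derivative F (at (x + s *\<^sub>R v' + h *\<^sub>R w')) v' \<bullet> b
         - frechet_derivative F (at (x + s *\<^sub>R v' + 0 *\<^sub>R w')) v' \<bullet> b" for s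
    have "(\<phi> has_real_derivative \<phi>' s) (at s)" if "0 \<le> s" "s \<le> h" for s
      unfolding \<phi>_def \<phi>'_def using d1[of s h] d1[of s 0] that h(1)
      by (auto intro!: derivative_intros)
    then obtain s where s: "0 < s" "s < h" "\<phi> h - \<phi> 0 = (h - 0) * \<phi>' s"
      using MVT2[of 0 h \<phi> \<phi>'] h(1) by auto
    have d2: "((\<lambda>t. frechet_derivative F (at (x + s *\<^sub>R v' + t *\<^sub>R w')) v' \<bullet> b) has_real_derivative
        D2 w' v' (x + s *\<^sub>R v' + t *\<^sub>R w')) (at t)" if "0 \<le> t" "t \<le> h" for t
    proof -
      let ?y = "x + s *\<^sub>R v' + t *\<^sub>R w'"
      have y: "?y \<in> S" using h(2) that s by simp
      have "((\<lambda>t. x + s *\<^sub>R v' + t *\<^sub>R w') has_derivative (\<lambda>t. t *\<^sub>R w')) (at t)"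
        by (auto intro!: derivative_eq_intros)
      from has_derivative_compose[OF this F2[OF y]]
      have "((\<lambda>t. frechet_derivative F (at (x + s *\<^sub>R v' + t *\<^sub>R w')) v' \<bullet> b) has_derivative
          (\<lambda>t. frechet_derivative (\<lambda>y. frechet_derivative F (at y) v') (at ?y) (t *\<^sub>R w') \<bullet> b)) (at t)"
        by (intro derivative_intros) auto
      then show ?thesis unfolding has_field_derivative_def D2_def
        by (rule has_derivative_eq_rhs)
          (simp add: linear_scale[OF has_derivative_linear[OF F2[OF y]]] fun_eq_iff)
    qed
    then obtain t where t: "0 < t" "t < h"
      "frechet_derivative F (at (x + s *\<^sub>R v' + h *\<^sub>R w')) v' \<bullet> b
         - frechet_derivative F (at (x + s *\<^sub>R v' + 0 *\<^sub>R w')) v' \<bullet> b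
       = (h - 0) * D2 w' v' (x + s *\<^sub>R v' + t *\<^sub>R w')"
      using MVT2[of 0 h "\<lambda>t. frechet_derivative F (at (x + s *\<^sub>R v' + t *\<^sub>R w')) v' \<bullet> b"
          "\<lambda>t. D2 w' v' (x + s *\<^sub>R v' + t *\<^sub>R w')"] h(1) by auto
    have "\<phi> h - \<phi> 0 = h * h * D2 w' v' (x + s *\<^sub>R v' + t *\<^sub>R w')"
      using s(3) t(3) by (simp add: \<phi>'_def)
    moreover have "\<phi> h - \<phi> 0 =
        F (x + h *\<^sub>R v' + h *\<^sub>R w') \<bullet> b - F (x + h *\<^sub>R v') \<bullet> b - F (x + h *\<^sub>R w') \<bullet> b + F x \<bullet> b"
      unfolding \<phi>_def by simp
    ultimately show ?thesis using s t by (metis less_imp_le)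
  qed
  have "D2 v w x = D2 w v x"
  proof (rule ccontr)
    assume ne: "D2 v w x \<noteq> D2 w v x"
    \<comment> \<open>Half the gap: equal numbers cannot lie within \<open>e\<close> of the two
      different mixed derivatives.\<close>
    define e where "e = \<bar>D2 v w x - D2 w v x\<bar> / 2"
    have e: "e > 0" using ne by (simp add: e_def)
    have "continuous (at x) (D2 v w)" "continuous (at x) (D2 w v)"
      using cont assms(2,3) continuous_on_eq_continuous_at by blast+
    then obtain d1 d2 where d: "d1 > 0" "d2 > 0"
      "\<And>y. dist y x < d1 \<Longrightarrow> dist (D2 v w y) (D2 v w x) < e"
      "\<And>y. dist y x < d2 \<Longrightarrow> dist (D2 w v y) (D2 w v x) < e"
      unfolding continuous_at_eps_delta using e by metis
    define m where "m = min r (min d1 d2)"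
    define h where "h = m / (2 * K)"
    have m: "m > 0" using r d by (simp add: m_def)
    have h: "h > 0" "h * K < m" using m K by (auto simp: h_def)
    have B: "x + s *\<^sub>R v + t *\<^sub>R w \<in> ball x m" "x + t *\<^sub>R w + s *\<^sub>R v \<in> ball x m"
      if "0 \<le> s" "s \<le> h" "0 \<le> t" "t \<le> h" for s t
      using inb[OF that h(2,1)] by (auto simp: algebra_simps)
    have S: "ball x m \<subseteq> S" using r unfolding m_def by auto
    obtain s t where 1: "0 \<le> s" "s \<le> h" "0 \<le> t" "t \<le> h"
      "F (x + h *\<^sub>R v + h *\<^sub>R w) \<bullet> b - F (x + h *\<^sub>R v) \<bullet> b - F (x + h *\<^sub>R w) \<bullet> b + F x \<bullet> b
        = h * h * D2 w v (x + s *\<^sub>R v + t *\<^sub>R w)"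
      using mvt[OF h(1), of v w] B S by blast
    obtain s' t' where 2: "0 \<le> s'" "s' \<le> h" "0 \<le> t'" "t' \<le> h"
      "F (x + h *\<^sub>R w + h *\<^sub>R v) \<bullet> b - F (x + h *\<^sub>R w) \<bullet> b - F (x + h *\<^sub>R v) \<bullet> b + F x \<bullet> b
        = h * h * D2 v w (x + s' *\<^sub>R w + t' *\<^sub>R v)"
      using mvt[OF h(1), of w v] B S by blast
    have "h * h * D2 w v (x + s *\<^sub>R v + t *\<^sub>R w) = h * h * D2 v w (x + s' *\<^sub>R w + t' *\<^sub>R v)"
      using 1(5) 2(5) by (simp add: algebra_simps)
    then have "D2 w v (x + s *\<^sub>R v + t *\<^sub>R w) = D2 v w (x + s' *\<^sub>R w + t' *\<^sub>R v)"
      using h(1) by simp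
    moreover have "dist (D2 w v (x + s *\<^sub>R v + t *\<^sub>R w)) (D2 w v x) < e"
      using B(1)[OF 1(1-4)] by (intro d(4)) (simp add: m_def dist_commute)
    moreover have "dist (D2 v w (x + s' *\<^sub>R w + t' *\<^sub>R v)) (D2 v w x) < e"
      using B(2)[OF 2(3,4,1,2)] by (intro d(3)) (simp add: m_def dist_commute)
    ultimately show False unfolding e_def dist_real_def by (smt (verit) field_sum_of_halves)
  qed
  then show "frechet_derivative (\<lambda>y. frechet_derivative F (at y) w) (at x) v \<bullet> b =
    frechet_derivative (\<lambda>y. frechet_derivative F (at y) v) (at x) w \<bullet> b" by (simp add: D2_def)
qed

subsection \<open>Bump functions\<close>

text \<open>The polynomial parameter makes this family of flat functions closed under
  differentiation, so smoothness can be proved for all members at once.\<close>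

definition flat_fun :: "real poly \<Rightarrow> real \<Rightarrow> real" where
  "flat_fun p t = (if t > 0 then poly p (inverse t) * exp (- inverse t) else 0)"

text \<open>With \<open>s = 1/t\<close> this says that the exponential dominates every polynomial at
  infinity.\<close>

lemma flat_fun_tendsto_0: "(flat_fun p \<longlongrightarrow> 0) (at_right 0)"
proof -
  have "((\<lambda>s. \<Sum>i\<le>degree p. coeff p i * (s ^ i / exp s)) \<longlongrightarrow> (\<Sum>i\<le>degree p. coeff p i * 0)) at_top"
    by (intro tendsto_intros tendsto_power_div_exp_0)
  then have "((\<lambda>s. poly p s * exp (- s)) \<longlongrightarrow> 0) at_top"
    by (simp add: poly_altdef sum_distrib_right exp_minus divide_inverse mult.assoc)
  then have "((\<lambda>t. poly p (inverse t) * exp (- inverse t)) \<longlongrightarrow> 0) (at_right 0)"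
    by (rule filterlim_compose[OF _ filterlim_inverse_at_top_right])
  moreover have "eventually (\<lambda>t. poly p (inverse t) * exp (- inverse t) = flat_fun p t) (at_right 0)"
    unfolding flat_fun_def using eventually_at_right_less by (rule eventually_mono) simp
  ultimately show ?thesis by (rule Lim_transform_eventually)
qed

text \<open>For \<open>t > 0\<close> the inner derivative contributes \<open>1/t^2\<close>, which is
  \<open>[:0, 0, 1:]\<close> at \<open>1/t\<close>; the exponential yields \<open>p\<close> and the
  polynomial factor yields \<open>- pderiv p\<close>. At \<open>t = 0\<close> the limit of the
  difference quotient is computed from both sides.\<close>

lemma flat_fun_has_derivative:
  "(flat_fun p has_real_derivative flat_fun ([:0, 0, 1:] * (p - pderiv p)) t) (at t)"
proof -
  consider "t > 0" | "t < 0" | "t = 0" by linarith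
  then show ?thesis
  proof cases
    case 1
    have "((\<lambda>t. poly p (inverse t) * exp (- inverse t)) has_real_derivative
        flat_fun ([:0, 0, 1:] * (p - pderiv p)) t) (at t)"
      using 1 by (auto intro!: derivative_eq_intros simp: flat_fun_def)
        (simp add: power2_eq_square field_simps)
    then show ?thesis
      by (rule has_field_derivative_transform_within_open[of _ _ _ "{0<..}"])
        (use 1 in \<open>auto simp: flat_fun_def\<close>)
  next
    case 2
    have "((\<lambda>t. 0) has_real_derivative flat_fun ([:0, 0, 1:] * (p - pderiv p)) t) (at t)"
      using 2 by (simp add: flat_fun_def)
    then show ?thesis
      by (rule has_field_derivative_transform_within_open[of _ _ _ "{..<0}"])
        (use 2 in \<open>auto simp: flat_fun_def\<close>)
  next
    case 3
    have "((\<lambda>h. (flat_fun p h - flat_fun p 0) / h) \<longlongrightarrow> 0) (at 0)"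
    proof (rule filterlim_split_at)
      have "((\<lambda>h. 0::real) \<longlongrightarrow> 0) (at_left 0)" by simp
      moreover have "eventually (\<lambda>h. 0 = (flat_fun p h - flat_fun p 0) / h) (at_left 0)"
        unfolding flat_fun_def eventually_at by (intro exI[of _ 1]) auto
      ultimately show "((\<lambda>h. (flat_fun p h - flat_fun p 0) / h) \<longlongrightarrow> 0) (at_left 0)"
        by (rule Lim_transform_eventually)
      \<comment> \<open>Dividing by \<open>h\<close> multiplies the polynomial in \<open>1/h\<close>
        by its variable, so the quotient is again a member of the family and tends to zero.\<close>
      have "eventually (\<lambda>h. flat_fun (pCons 0 p) h = (flat_fun p h - flat_fun p 0) / h) (at_right 0)"
        unfolding flat_fun_def eventually_at by (intro exI[of _ 1]) (auto simp: field_simps)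
      then show "((\<lambda>h. (flat_fun p h - flat_fun p 0) / h) \<longlongrightarrow> 0) (at_right 0)"
        by (rule Lim_transform_eventually[OF flat_fun_tendsto_0])
    qed
    then have "((\<lambda>y. (flat_fun p y - flat_fun p t) / (y - t)) \<longlongrightarrow> 0) (at t)" using 3 by simp
    then show ?thesis using 3 by (simp add: has_field_derivative_iff flat_fun_def)
  qed
qed

lemma flat_fun_smooth: "smooth_on UNIV (flat_fun p)"
proof -
  have "Ck_on k UNIV (flat_fun p)" for k
  proof (induction k arbitrary: p)
    case 0
    then show ?case
      using DERIV_isCont[OF flat_fun_has_derivative] by (simp add: continuous_at_imp_continuous_on)
  next
    case (Suc k)
    let ?q = "[:0, 0, 1:] * (p - pderiv p)"
    have "frechet_derivative (flat_fun p) (at t) v = flat_fun ?q t * v" for t v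
      using flat_fun_has_derivative[of p t] unfolding has_field_derivative_def
      by (rule frechet_derivative_eqI)
    moreover have "Ck_on k UNIV (\<lambda>t. flat_fun ?q t * v)" for v
      by (intro Ck_on_bilinear[OF bounded_bilinear_mult] Suc Ck_on_const open_UNIV)
    moreover have "flat_fun p differentiable_on UNIV"
      using flat_fun_has_derivative unfolding has_field_derivative_def
      by (auto simp: differentiable_on_def differentiable_def)
    ultimately show ?case by simp
  qed
  then show ?thesis by (simp add: smooth_on_def)
qed

text \<open>Compose \<open>flat_fun 1\<close>, which vanishes exactly on the nonpositive reals, with
  a function that is positive only inside the ball, and divide by the value at the centre.\<close>

lemma smooth_bump:
  fixes x0 :: "'a::euclidean_space"
  assumes "r > 0"
  obtains \<phi> :: "'a \<Rightarrow> real" where "smooth_on UNIV \<phi>" "\<phi> x0 = 1" "\<And>x. x \<notin> cball x0 r \<Longrightarrow> \<phi> x = 0"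
proof -
  \<comment> \<open>This is \<open>r^2 - |x - x0|^2\<close>, spelled with sums and products so that
    the closure rules for \<open>smooth_on\<close> apply as it stands.\<close>
  define \<sigma> where "\<sigma> x = r\<^sup>2 + - 1 * ((x + - x0) \<bullet> (x + - x0))" for x :: 'a
  have l: "smooth_on UNIV (\<lambda>x. x + - x0)"
    by (intro smooth_on_add smooth_on_const smooth_on_bounded_linear bounded_linear_ident open_UNIV)
  have "smooth_on UNIV \<sigma>"
    unfolding \<sigma>_def
    by (intro smooth_on_add smooth_on_bilinear[OF bounded_bilinear_mult]
        smooth_on_bilinear[OF bounded_bilinear_inner] smooth_on_const l open_UNIV)
  then have s: "smooth_on UNIV (flat_fun 1 \<circ> \<sigma>)"
    by (intro smooth_on_compose[OF open_UNIV open_UNIV _ _ flat_fun_smooth]) auto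
  have "smooth_on UNIV (\<lambda>x. (flat_fun 1 \<circ> \<sigma>) x * inverse ((flat_fun 1 \<circ> \<sigma>) x0))"
    by (intro smooth_on_bilinear[OF bounded_bilinear_mult] smooth_on_const s open_UNIV)
  moreover have "flat_fun 1 (\<sigma> x0) \<noteq> 0" using assms by (simp add: flat_fun_def \<sigma>_def)
  moreover have "flat_fun 1 (\<sigma> x) = 0" if "x \<notin> cball x0 r" for x
  proof -
    have "r < norm (x + - x0)" using that by (simp add: dist_norm norm_minus_commute)
    then have "r\<^sup>2 < norm (x + - x0) ^ 2" using assms by (intro power_strict_mono) auto
    then show ?thesis by (simp add: flat_fun_def \<sigma>_def power2_norm_eq_inner)
  qed
  ultimately show ?thesis using that[of "\<lambda>x. (flat_fun 1 \<circ> \<sigma>) x * inverse ((flat_fun 1 \<circ> \<sigma>) x0)"]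
    by simp
qed

subsection \<open>Charts, derivatives and vector fields\<close>

lemma chart_props:
  assumes "smooth_manifold M" "c \<in> M"
  shows "open (cdom c)" "open (cmap c ` cdom c)" "continuous_on (cdom c) (cmap c)"
    "continuous_on (cmap c ` cdom c) (cinv c)" "homeomorphism (cdom c) (cmap c ` cdom c) (cmap c) (cinv c)"
    "\<And>p. p \<in> cdom c \<Longrightarrow> cinv c (cmap c p) = p"
    "\<And>x. x \<in> cmap c ` cdom c \<Longrightarrow> cmap c (cinv c x) = x"
    "\<And>x. x \<in> cmap c ` cdom c \<Longrightarrow> cinv c x \<in> cdom c"
  using assms unfolding smooth_manifold_def is_chart_def homeomorphism_def by auto

lemma chart_at:
  assumes "smooth_manifold M"
  shows "chart_at M p \<in> M" "p \<in> cdom (chart_at M p)"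
proof -
  have "\<exists>c. c \<in> M \<and> p \<in> cdom c"
    using assms unfolding smooth_manifold_def by blast
  from someI_ex[OF this] show "chart_at M p \<in> M" "p \<in> cdom (chart_at M p)"
    by (auto simp: chart_at_def)
qed

lemma open_chart_image:
  assumes "smooth_manifold M" "c \<in> M" "open U"
  shows "open (cmap c ` (cdom c \<inter> U))"
proof -
  note cp = chart_props[OF assms(1,2)]
  have "openin (top_of_set (cmap c ` cdom c)) (cmap c ` (cdom c \<inter> U))"
    using assms(3) by (intro homeomorphism_imp_open_map[OF cp(5)]) blast
  then show ?thesis using cp(2) openin_open_trans by blast
qed

text \<open>A relational form of \<open>tderiv\<close>, whose value is arbitrary where no derivative
  exists. It carries differentiability along, so the rules for \<open>has_derivative\<close>
  transfer.\<close>

definition has_tderiv ::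
  "('m, 'e::euclidean_space) atlas \<Rightarrow> 'm \<Rightarrow> ('m \<Rightarrow> 'v::real_normed_vector) \<Rightarrow> ('e \<Rightarrow> 'v) \<Rightarrow> bool" where
  "has_tderiv M p h D \<longleftrightarrow>
     (h \<circ> cinv (chart_at M p) has_derivative D) (at (cmap (chart_at M p) p))"

definition tdiff :: "('m, 'e::euclidean_space) atlas \<Rightarrow> 'm \<Rightarrow> ('m \<Rightarrow> 'v::real_normed_vector) \<Rightarrow> bool" where
  "tdiff M p h \<longleftrightarrow> has_tderiv M p h (tderiv M p h)"

lemma has_tderiv_eq: "has_tderiv M p h D \<Longrightarrow> tderiv M p h v = D v"
  unfolding has_tderiv_def tderiv_def by (rule frechet_derivative_eqI)

lemma has_tderiv_tdiff:
  assumes "has_tderiv M p h D"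
  shows "tdiff M p h"
proof -
  have "tderiv M p h = D" by (rule ext) (rule has_tderiv_eq[OF assms])
  then show ?thesis using assms by (simp add: tdiff_def)
qed

lemma has_tderiv_linear: "has_tderiv M p h D \<Longrightarrow> linear D"
  unfolding has_tderiv_def by (rule has_derivative_linear)

lemma has_tderiv_const: "has_tderiv M p (\<lambda>q. k) (\<lambda>v. 0)"
  unfolding has_tderiv_def o_def by simp

lemma has_tderiv_add:
  "has_tderiv M p h D \<Longrightarrow> has_tderiv M p k E \<Longrightarrow> has_tderiv M p (\<lambda>q. h q + k q) (\<lambda>v. D v + E v)"
  unfolding has_tderiv_def o_def by (rule has_derivative_add)

lemma has_tderiv_sum:
  "(\<And>i. i \<in> I \<Longrightarrow> has_tderiv M p (h i) (D i)) \<Longrightarrow>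
   has_tderiv M p (\<lambda>q. \<Sum>i\<in>I. h i q) (\<lambda>v. \<Sum>i\<in>I. D i v)"
  unfolding has_tderiv_def o_def by (rule has_derivative_sum)

lemma has_tderiv_bounded_linear:
  "bounded_linear L \<Longrightarrow> has_tderiv M p h D \<Longrightarrow> has_tderiv M p (\<lambda>q. L (h q)) (\<lambda>v. L (D v))"
  unfolding has_tderiv_def o_def by (rule bounded_linear.has_derivative)

lemma has_tderiv_cong:
  assumes "smooth_manifold M" "open U" "p \<in> U" "\<And>q. q \<in> U \<Longrightarrow> h q = k q" "has_tderiv M p h D"
  shows "has_tderiv M p k D"
proof -
  let ?c = "chart_at M p"
  note cp = chart_props[OF assms(1) chart_at(1)[OF assms(1), of p]]
  show ?thesis
    using assms(5) unfolding has_tderiv_def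
  proof (rule has_derivative_transform_within_open)
    show "open (cmap ?c ` (cdom ?c \<inter> U))"
      using assms chart_at by (intro open_chart_image)
    show "cmap ?c p \<in> cmap ?c ` (cdom ?c \<inter> U)" using chart_at[OF assms(1)] assms(3) by auto
    show "(h \<circ> cinv ?c) x = (k \<circ> cinv ?c) x" if "x \<in> cmap ?c ` (cdom ?c \<inter> U)" for x
      using that cp(6) assms(4) by auto
  qed
qed

lemma tderiv_cong:
  assumes "smooth_manifold M" "open U" "p \<in> U" "\<And>q. q \<in> U \<Longrightarrow> h q = k q"
  shows "tderiv M p h = tderiv M p k" "tdiff M p h \<longleftrightarrow> tdiff M p k"
proof -
  have *: "has_tderiv M p h D \<longleftrightarrow> has_tderiv M p k D" for D
    using has_tderiv_cong[OF assms(1-3)] assms(4) by metis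
  then show 1: "tderiv M p h = tderiv M p k"
    unfolding tderiv_def frechet_derivative_def has_tderiv_def by simp
  show "tdiff M p h \<longleftrightarrow> tdiff M p k" unfolding tdiff_def using * 1 by simp
qed

lemma has_tderiv_bilinear:
  assumes "smooth_manifold M" "bounded_bilinear B" "has_tderiv M p h D" "has_tderiv M p k E"
  shows "has_tderiv M p (\<lambda>q. B (h q) (k q)) (\<lambda>v. B (h p) (E v) + B (D v) (k p))"
  using bounded_bilinear.FDERIV[OF assms(2) assms(3,4)[unfolded has_tderiv_def]]
    chart_props(6)[OF assms(1) chart_at[OF assms(1)], of p]
  unfolding has_tderiv_def o_def by simp

section \<open>Change of charts\<close>

lemma transition_has_derivative:
  assumes "smooth_manifold M" "c \<in> M" "d \<in> M" "q \<in> cdom c" "q \<in> cdom d"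
  shows "(cmap d \<circ> cinv c has_derivative frechet_derivative (cmap d \<circ> cinv c) (at (cmap c q)))
    (at (cmap c q))"
proof (rule smooth_on_imp_has_derivative)
  show "smooth_on (cmap c ` (cdom c \<inter> cdom d)) (cmap d \<circ> cinv c)"
    using assms unfolding smooth_manifold_def by blast
  show "open (cmap c ` (cdom c \<inter> cdom d))"
    using assms chart_props(1) by (intro open_chart_image) blast+
  show "cmap c q \<in> cmap c ` (cdom c \<inter> cdom d)" using assms by blast
qed

lemma has_tderiv_cmap:
  assumes "smooth_manifold M" "c \<in> M" "p \<in> cdom c"
  shows "has_tderiv M p (cmap c) (tcoord M c p)"
  unfolding has_tderiv_def tcoord_def[abs_def] tderiv_def
  using transition_has_derivative[OF assms(1) chart_at(1)[OF assms(1)] assms(2) chart_at(2)[OF assms(1)] assms(3)]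
  by simp

lemma coord_field_has_derivative:
  assumes "smooth_manifold M" "c \<in> M" "p \<in> cdom c"
  shows "(cmap (chart_at M p) \<circ> cinv c has_derivative (\<lambda>w. coord_field M c w p)) (at (cmap c p))"
  unfolding coord_field_def
  using transition_has_derivative[OF assms(1,2) chart_at(1)[OF assms(1)] assms(3) chart_at(2)[OF assms(1)]]
  by simp

lemma tcoord_linear:
  "smooth_manifold M \<Longrightarrow> c \<in> M \<Longrightarrow> p \<in> cdom c \<Longrightarrow> linear (tcoord M c p)"
  by (rule has_tderiv_linear[OF has_tderiv_cmap])

lemma coord_field_linear:
  "smooth_manifold M \<Longrightarrow> c \<in> M \<Longrightarrow> p \<in> cdom c \<Longrightarrow> linear (\<lambda>w. coord_field M c w p)"
  by (rule has_derivative_linear[OF coord_field_has_derivative])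

text \<open>Factor \<open>h\<close> through \<open>c\<close>: the inner map is the transition from
  the selected chart to \<open>c\<close>, with derivative \<open>tcoord M c p\<close>. The
  factorisation holds on \<open>cdom c\<close> only, which locality makes sufficient.\<close>

lemma has_tderiv_chart:
  assumes "smooth_manifold M" "c \<in> M" "p \<in> cdom c"
    and "(h \<circ> cinv c has_derivative D) (at (cmap c p))"
  shows "has_tderiv M p h (\<lambda>v. D (tcoord M c p v))"
proof -
  let ?d = "chart_at M p"
  note cp = chart_props[OF assms(1,2)] and dp = chart_props[OF assms(1) chart_at(1)[OF assms(1), of p]]
  have "cinv ?d (cmap ?d p) = p" using dp(6) chart_at(2)[OF assms(1)] by blast
  then have "(h \<circ> cinv c has_derivative D) (at ((cmap c \<circ> cinv ?d) (cmap ?d p)))"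
    using assms(4) by simp
  from diff_chain_at[OF has_tderiv_cmap[OF assms(1-3), unfolded has_tderiv_def] this]
  have "(h \<circ> cinv c \<circ> (cmap c \<circ> cinv ?d) has_derivative (\<lambda>v. D (tcoord M c p v))) (at (cmap ?d p))"
    by (simp add: o_def)
  moreover have "((h \<circ> cinv c \<circ> (cmap c \<circ> cinv ?d) has_derivative (\<lambda>v. D (tcoord M c p v))) (at (cmap ?d p)))
    \<longleftrightarrow> has_tderiv M p (h \<circ> cinv c \<circ> cmap c) (\<lambda>v. D (tcoord M c p v))"
    by (simp add: has_tderiv_def comp_assoc)
  ultimately have "has_tderiv M p (h \<circ> cinv c \<circ> cmap c) (\<lambda>v. D (tcoord M c p v))" by simp
  then show ?thesis
    by (rule has_tderiv_cong[OF assms(1) cp(1) assms(3), rotated]) (simp add: cp(6))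
qed

text \<open>The opposite passage, through the transition from \<open>c\<close> to the selected
  chart, whose derivative is given by \<open>coord_field\<close>.\<close>

lemma has_derivative_chart:
  assumes "smooth_manifold M" "c \<in> M" "p \<in> cdom c" "has_tderiv M p h D"
  shows "(h \<circ> cinv c has_derivative (\<lambda>w. D (coord_field M c w p))) (at (cmap c p))"
proof -
  let ?d = "chart_at M p"
  note cp = chart_props[OF assms(1,2)] and dp = chart_props[OF assms(1) chart_at(1)[OF assms(1), of p]]
  have "(h \<circ> cinv ?d has_derivative D) (at ((cmap ?d \<circ> cinv c) (cmap c p)))"
    using assms(4) cp(6)[OF assms(3)] unfolding has_tderiv_def by simp
  from diff_chain_at[OF coord_field_has_derivative[OF assms(1-3)] this]
  have "(h \<circ> cinv ?d \<circ> (cmap ?d \<circ> cinv c) has_derivative (\<lambda>w. D (coord_field M c w p))) (at (cmap c p))"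
    by (simp add: o_def)
  then show ?thesis
  proof (rule has_derivative_transform_within_open)
    show "open (cmap c ` (cdom c \<inter> cdom ?d))"
      using assms dp(1) by (intro open_chart_image)
    show "cmap c p \<in> cmap c ` (cdom c \<inter> cdom ?d)" using chart_at(2)[OF assms(1)] assms(3) by blast
    show "(h \<circ> cinv ?d \<circ> (cmap ?d \<circ> cinv c)) x = (h \<circ> cinv c) x"
      if "x \<in> cmap c ` (cdom c \<inter> cdom ?d)" for x
      using that cp(6) dp(6) by auto
  qed
qed

lemma tderiv_chart:
  assumes "smooth_manifold M" "c \<in> M" "p \<in> cdom c" "tdiff M p h"
  shows "tderiv M p h v = frechet_derivative (h \<circ> cinv c) (at (cmap c p)) (tcoord M c p v)"
    "(h \<circ> cinv c has_derivative frechet_derivative (h \<circ> cinv c) (at (cmap c p))) (at (cmap c p))"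
proof -
  show 1: "(h \<circ> cinv c has_derivative frechet_derivative (h \<circ> cinv c) (at (cmap c p))) (at (cmap c p))"
    using has_derivative_chart[OF assms(1-3) assms(4)[unfolded tdiff_def]]
    by (intro frechet_derivative_works_at differentiableI)
  show "tderiv M p h v = frechet_derivative (h \<circ> cinv c) (at (cmap c p)) (tcoord M c p v)"
    by (rule has_tderiv_eq[OF has_tderiv_chart[OF assms(1-3) 1]])
qed

text \<open>As functions of \<open>w\<close> both sides are derivatives of
  \<open>cmap c \<circ> cinv c\<close>, which is the identity on the chart image.\<close>

lemma tcoord_coord_field:
  assumes "smooth_manifold M" "c \<in> M" "p \<in> cdom c"
  shows "tcoord M c p (coord_field M c w p) = w"
proof -
  have "(cmap c \<circ> cinv c has_derivative (\<lambda>w. tcoord M c p (coord_field M c w p))) (at (cmap c p))"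
    by (rule has_derivative_chart[OF assms has_tderiv_cmap[OF assms]])
  moreover have "(cmap c \<circ> cinv c has_derivative (\<lambda>w. w)) (at (cmap c p))"
    by (rule has_derivative_transform_within_open[OF has_derivative_ident, of "cmap c ` cdom c"])
      (use chart_props[OF assms(1,2)] assms(3) in auto)
  ultimately show ?thesis using has_derivative_unique by metis
qed

text \<open>The same argument in the selected chart; thus \<open>tcoord\<close> and
  \<open>coord_field\<close> are mutually inverse coordinate changes.\<close>

lemma coord_field_tcoord:
  assumes "smooth_manifold M" "c \<in> M" "p \<in> cdom c"
  shows "coord_field M c (tcoord M c p v) p = v"
proof -
  let ?d = "chart_at M p"
  have "has_tderiv M p (cmap ?d) (\<lambda>v. coord_field M c (tcoord M c p v) p)"
    by (rule has_tderiv_chart[OF assms coord_field_has_derivative[OF assms]])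
  moreover have "has_tderiv M p (cmap ?d) (\<lambda>v. v)"
    unfolding has_tderiv_def
    by (rule has_derivative_transform_within_open[OF has_derivative_ident, of "cmap ?d ` cdom ?d"])
      (use chart_props[OF assms(1) chart_at(1)[OF assms(1)]] chart_at(2)[OF assms(1)] in auto)
  ultimately show ?thesis using has_tderiv_eq by metis
qed

lemma tcoord_chart_at:
  assumes "smooth_manifold M"
  shows "tcoord M (chart_at M p) p v = v"
proof -
  let ?d = "chart_at M p"
  have "has_tderiv M p (cmap ?d) (\<lambda>v. v)"
    unfolding has_tderiv_def
    by (rule has_derivative_transform_within_open[OF has_derivative_ident, of "cmap ?d ` cdom ?d"])
      (use chart_props[OF assms chart_at(1)[OF assms]] chart_at(2)[OF assms] in auto)
  then show ?thesis unfolding tcoord_def by (rule has_tderiv_eq)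
qed

lemma coord_field_chart_at:
  assumes "smooth_manifold M"
  shows "coord_field M (chart_at M p) w p = w"
  using coord_field_tcoord[OF assms chart_at[OF assms], of p w] tcoord_chart_at[OF assms] by simp

lemma has_tderiv_chain:
  assumes "smooth_manifold M" "smooth_manifold N" "continuous_on UNIV f"
    and "has_tderiv N (f p) h D" "has_tderiv M p (cmap (chart_at N (f p)) \<circ> f) E"
  shows "has_tderiv M p (\<lambda>q. h (f q)) (\<lambda>v. D (E v))"
proof -
  let ?c = "chart_at M p" and ?d = "chart_at N (f p)"
  note dp = chart_props[OF assms(2) chart_at(1)[OF assms(2), of "f p"]]
  have "cinv ?c (cmap ?c p) = p" using chart_props(6) chart_at assms(1) by metis
  then have "(h \<circ> cinv ?d has_derivative D) (at ((cmap ?d \<circ> f \<circ> cinv ?c) (cmap ?c p)))"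
    using assms(4) by (simp add: has_tderiv_def)
  from diff_chain_at[OF assms(5)[unfolded has_tderiv_def] this]
  have "has_tderiv M p (\<lambda>q. h (cinv ?d (cmap ?d (f q)))) (\<lambda>v. D (E v))"
    by (simp add: has_tderiv_def o_def)
  then show ?thesis
  proof (rule has_tderiv_cong[OF assms(1), rotated 3])
    show "open (f -` cdom ?d)" using assms(3) dp(1) by (simp add: open_vimage)
    show "p \<in> f -` cdom ?d" using chart_at[OF assms(2)] by simp
    show "h (cinv ?d (cmap ?d (f q))) = h (f q)" if "q \<in> f -` cdom ?d" for q
      using that dp(6) by simp
  qed
qed

section \<open>Smooth functions and vector fields on open sets\<close>

text \<open>Composition with the transition from \<open>d\<close> to \<open>c\<close>. It reduces
  smoothness in every chart to smoothness in one chart that contains \<open>U\<close>.\<close>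

lemma smooth_on_chart_change:
  assumes "smooth_manifold M" "c \<in> M" "d \<in> M" "open U" "U \<subseteq> cdom c"
    and "smooth_on (cmap c ` U) k"
  shows "smooth_on (cmap d ` (cdom d \<inter> U)) (\<lambda>x. k (cmap c (cinv d x)))"
proof -
  note cp = chart_props[OF assms(1,2)] and dp = chart_props[OF assms(1,3)]
  have "smooth_on (cmap d ` (cdom d \<inter> U)) (k \<circ> (cmap c \<circ> cinv d))"
  proof (rule smooth_on_compose)
    show "open (cmap d ` (cdom d \<inter> U))" by (rule open_chart_image[OF assms(1,3,4)])
    show "open (cmap c ` U)"
      using open_chart_image[OF assms(1,2,4)] assms(5) by (simp add: Int_absorb1)
    show "(cmap c \<circ> cinv d) ` cmap d ` (cdom d \<inter> U) \<subseteq> cmap c ` U" using dp(6) by auto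
    have "smooth_on (cmap d ` (cdom d \<inter> cdom c)) (cmap c \<circ> cinv d)"
      using assms unfolding smooth_manifold_def by blast
    then show "smooth_on (cmap d ` (cdom d \<inter> U)) (cmap c \<circ> cinv d)"
      using assms(5) by (elim smooth_on_subset) auto
  qed (rule assms)
  then show ?thesis by (simp add: o_def)
qed

lemma smooth_fun_onI_chart:
  assumes "smooth_manifold M" "c \<in> M" "open U" "U \<subseteq> cdom c" "smooth_on (cmap c ` U) (h \<circ> cinv c)"
  shows "smooth_fun_on M U h"
  unfolding smooth_fun_on_def
proof
  fix d assume d: "d \<in> M"
  show "smooth_on (cmap d ` (cdom d \<inter> U)) (h \<circ> cinv d)"
    using smooth_on_chart_change[OF assms(1,2) d assms(3-5)]
    by (rule smooth_on_cong[THEN iffD1, rotated 2])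
      (use open_chart_image[OF assms(1) d assms(3)] assms(4) chart_props(6)[OF assms(1) d]
        chart_props(6)[OF assms(1,2)] in \<open>auto simp: subset_iff\<close>)
qed

lemma smooth_fun_on_tdiff:
  assumes "smooth_manifold M" "smooth_fun_on M U h" "open U" "p \<in> U"
  shows "tdiff M p h"
proof -
  let ?c = "chart_at M p"
  have "(h \<circ> cinv ?c has_derivative frechet_derivative (h \<circ> cinv ?c) (at (cmap ?c p))) (at (cmap ?c p))"
    using assms chart_at[OF assms(1)] unfolding smooth_fun_on_def
    by (intro smooth_on_imp_has_derivative[of "cmap ?c ` (cdom ?c \<inter> U)"]) (auto intro: open_chart_image)
  then show ?thesis by (intro has_tderiv_tdiff) (simp add: has_tderiv_def)
qed

lemma vector_field_on_tdiff:
  assumes "smooth_manifold M" "vector_field_on M U X" "open U" "p \<in> U" "c \<in> M" "p \<in> cdom c"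
  shows "tdiff M p (\<lambda>q. tcoord M c q (X q))"
proof -
  let ?h = "(\<lambda>q. tcoord M c q (X q)) \<circ> cinv c"
  have "(?h has_derivative frechet_derivative ?h (at (cmap c p))) (at (cmap c p))"
    using assms unfolding vector_field_on_def
    by (intro smooth_on_imp_has_derivative[of "cmap c ` (cdom c \<inter> U)"]) (auto intro: open_chart_image)
  from has_tderiv_tdiff[OF has_tderiv_chart[OF assms(1,5,6) this]] show ?thesis .
qed

lemma vector_field_on_subset: "vector_field_on M U X \<Longrightarrow> V \<subseteq> U \<Longrightarrow> vector_field_on M V X"
  unfolding vector_field_on_def by (blast intro: smooth_on_subset)

lemma smooth_fun_on_const: "smooth_fun_on M U (\<lambda>q. k)"
  unfolding smooth_fun_on_def o_def by (simp add: smooth_on_const)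

lemma vector_field_on_cong:
  assumes "smooth_manifold M" "open U" "\<And>q. q \<in> U \<Longrightarrow> X q = Y q" "vector_field_on M U X"
  shows "vector_field_on M U Y"
  unfolding vector_field_on_def
proof
  fix c assume c: "c \<in> M"
  then have "smooth_on (cmap c ` (cdom c \<inter> U)) ((\<lambda>q. tcoord M c q (X q)) \<circ> cinv c)"
    using assms unfolding vector_field_on_def by blast
  then show "smooth_on (cmap c ` (cdom c \<inter> U)) ((\<lambda>q. tcoord M c q (Y q)) \<circ> cinv c)"
    by (rule smooth_on_cong[THEN iffD1, rotated 2])
      (use assms c chart_props(6)[OF assms(1) c] in \<open>auto intro: open_chart_image\<close>)
qed

lemma vector_field_on_add:
  assumes "smooth_manifold M" "open U" "vector_field_on M U X" "vector_field_on M U Y"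
  shows "vector_field_on M U (\<lambda>q. X q + Y q)"
  unfolding vector_field_on_def
proof
  fix c assume c: "c \<in> M"
  let ?S = "cmap c ` (cdom c \<inter> U)"
  have o: "open ?S" using assms c by (intro open_chart_image)
  have "smooth_on ?S (\<lambda>x. ((\<lambda>q. tcoord M c q (X q)) \<circ> cinv c) x + ((\<lambda>q. tcoord M c q (Y q)) \<circ> cinv c) x)"
    using assms c o unfolding vector_field_on_def by (intro smooth_on_add) blast+
  then show "smooth_on ?S ((\<lambda>q. tcoord M c q (X q + Y q)) \<circ> cinv c)"
    by (rule smooth_on_cong[THEN iffD1, rotated 2])
      (use o chart_props(6)[OF assms(1) c] tcoord_linear[OF assms(1) c] in \<open>auto simp: linear_add\<close>)
qed

lemma vector_field_on_scaleR:
  assumes "smooth_manifold M" "open U" "smooth_fun_on M U h" "vector_field_on M U X"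
  shows "vector_field_on M U (\<lambda>q. h q *\<^sub>R X q)"
  unfolding vector_field_on_def
proof
  fix c assume c: "c \<in> M"
  let ?S = "cmap c ` (cdom c \<inter> U)"
  have o: "open ?S" using assms c by (intro open_chart_image)
  have "smooth_on ?S (\<lambda>x. (h \<circ> cinv c) x *\<^sub>R ((\<lambda>q. tcoord M c q (X q)) \<circ> cinv c) x)"
    using assms c o unfolding vector_field_on_def smooth_fun_on_def
    by (intro smooth_on_bilinear[OF bounded_bilinear_scaleR]) blast+
  then show "smooth_on ?S ((\<lambda>q. tcoord M c q (h q *\<^sub>R X q)) \<circ> cinv c)"
    by (rule smooth_on_cong[THEN iffD1, rotated 2])
      (use o chart_props(6)[OF assms(1) c] tcoord_linear[OF assms(1) c] in \<open>auto simp: linear_scale\<close>)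
qed

lemma vector_field_on_zero:
  assumes "smooth_manifold M" "open U"
  shows "vector_field_on M U (\<lambda>q. 0)"
  unfolding vector_field_on_def
proof
  fix c assume c: "c \<in> M"
  let ?S = "cmap c ` (cdom c \<inter> U)"
  show "smooth_on ?S ((\<lambda>q. tcoord M c q 0) \<circ> cinv c)"
    by (rule smooth_on_cong[THEN iffD1, rotated 2, OF smooth_on_const[of _ 0]])
      (use assms(2) open_chart_image[OF assms(1) c] chart_props(6)[OF assms(1) c]
        tcoord_linear[OF assms(1) c] in \<open>auto simp: linear_0\<close>)
qed

lemma vector_field_on_sum:
  assumes "smooth_manifold M" "open U" "\<And>i. i \<in> I \<Longrightarrow> vector_field_on M U (X i)"
  shows "vector_field_on M U (\<lambda>q. \<Sum>i\<in>I. X i q)"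
  using assms(3) by (induction I rule: infinite_finite_induct)
    (simp_all add: vector_field_on_zero vector_field_on_add assms(1,2))

lemma tcoord_coord_field_other:
  assumes "smooth_manifold M" "c \<in> M" "d \<in> M" "q \<in> cdom c" "q \<in> cdom d"
  shows "tcoord M d q (coord_field M c w q) = frechet_derivative (cmap d \<circ> cinv c) (at (cmap c q)) w"
  using has_tderiv_eq[OF has_tderiv_chart[OF assms(1,2,4) transition_has_derivative[OF assms]],
      of "coord_field M c w q"] tcoord_coord_field[OF assms(1,2,4)]
  by (simp add: tcoord_def)

text \<open>In another chart \<open>d\<close> the components are directional derivatives of the
  transition map. They are smooth on the image of \<open>c\<close>, and
  \<open>smooth_on_chart_change\<close> carries them to the image of \<open>d\<close>.\<close>

lemma coord_field_vector_field:
  assumes "smooth_manifold M" "c \<in> M"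
  shows "vector_field_on M (cdom c) (coord_field M c w)"
  unfolding vector_field_on_def
proof
  fix d assume d: "d \<in> M"
  note cp = chart_props[OF assms] and dp = chart_props[OF assms(1) d]
  have "smooth_on (cmap c ` (cdom c \<inter> cdom d)) (\<lambda>x. frechet_derivative (cmap d \<circ> cinv c) (at x) w)"
    using assms d unfolding smooth_manifold_def by (intro smooth_on_frechet_derivative) blast
  from smooth_on_chart_change[OF assms d _ _ this]
  have "smooth_on (cmap d ` (cdom d \<inter> cdom c))
     (\<lambda>x. frechet_derivative (cmap d \<circ> cinv c) (at (cmap c (cinv d x))) w)"
    using cp(1) dp(1) by (auto simp: Int_ac)
  then show "smooth_on (cmap d ` (cdom d \<inter> cdom c))
     ((\<lambda>q. tcoord M d q (coord_field M c w q)) \<circ> cinv d)"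
    by (rule smooth_on_cong[THEN iffD1, rotated 2])
      (use cp(1) dp(6) open_chart_image[OF assms(1) d] tcoord_coord_field_other[OF assms d] in auto)
qed

lemma vector_field_on_component:
  assumes "smooth_manifold M" "vector_field_on M U X" "open U" "c \<in> M" "U \<subseteq> cdom c"
  shows "smooth_fun_on M U (\<lambda>q. tcoord M c q (X q) \<bullet> b)"
proof (rule smooth_fun_onI_chart)
  have "cdom c \<inter> U = U" using assms(5) by blast
  then have o: "open (cmap c ` U)" using open_chart_image[OF assms(1,4,3)] by simp
  have "smooth_on (cmap c ` U) (\<lambda>x. ((\<lambda>q. tcoord M c q (X q)) \<circ> cinv c) x \<bullet> b)"
    using assms \<open>cdom c \<inter> U = U\<close> unfolding vector_field_on_def
    by (intro smooth_on_bilinear[OF bounded_bilinear_inner] smooth_on_const o) metis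
  then show "smooth_on (cmap c ` U) ((\<lambda>q. tcoord M c q (X q) \<bullet> b) \<circ> cinv c)" by (simp add: o_def)
qed (use assms in auto)

text \<open>\<open>normal_structure\<close> speaks of global fields only, so pointwise conclusions
  require tangent vectors to extend. The extension is a coordinate field cut off by a bump
  function.\<close>

lemma vector_field_extension:
  assumes "smooth_manifold (M :: ('m::{t2_space,second_countable_topology}, 'e::euclidean_space) atlas)"
  obtains X where "vector_field M X" "X p = v"
proof -
  let ?c = "chart_at M p"
  note cp = chart_props[OF assms chart_at(1)[OF assms, of p]]
  have "cmap ?c p \<in> cmap ?c ` cdom ?c" using chart_at(2)[OF assms] by blast
  then obtain r where r: "r > 0" "cball (cmap ?c p) r \<subseteq> cmap ?c ` cdom ?c"
    using cp(2) open_contains_cball by blast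
  define K where "K = cinv ?c ` cball (cmap ?c p) r"
  have "compact K" unfolding K_def
    using continuous_on_subset[OF cp(4) r(2)] by (intro compact_continuous_image) auto
  \<comment> \<open>The Hausdorff property enters here: \<open>- K\<close> is open, and together
    with the chart domain it covers the manifold.\<close>
  then have "closed K" by (rule compact_imp_closed)
  have Kc: "K \<subseteq> cdom ?c" using r(2) cp(8) unfolding K_def by auto
  obtain \<phi> :: "'e \<Rightarrow> real" where \<phi>: "smooth_on UNIV \<phi>" "\<phi> (cmap ?c p) = 1"
    "\<And>x. x \<notin> cball (cmap ?c p) r \<Longrightarrow> \<phi> x = 0"
    using smooth_bump[OF r(1)] by metis
  define X where "X q = (if q \<in> cdom ?c then \<phi> (cmap ?c q) *\<^sub>R coord_field M ?c v q else 0)" for q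
  have "smooth_fun_on M (cdom ?c) (\<lambda>q. \<phi> (cmap ?c q))"
  proof (rule smooth_fun_onI_chart[OF assms chart_at(1)[OF assms] cp(1) order_refl])
    show "smooth_on (cmap ?c ` cdom ?c) ((\<lambda>q. \<phi> (cmap ?c q)) \<circ> cinv ?c)"
      by (rule smooth_on_cong[THEN iffD1, rotated 2, OF smooth_on_subset[OF \<phi>(1)]])
        (use cp(2,7) in auto)
  qed
  from vector_field_on_scaleR[OF assms cp(1) this
      coord_field_vector_field[OF assms chart_at(1)[OF assms], where w = v]]
  have 1: "vector_field_on M (cdom ?c) X"
    by (rule vector_field_on_cong[OF assms cp(1), rotated]) (simp add: X_def)
  \<comment> \<open>Off \<open>K\<close> the bump factor vanishes, also inside the chart domain, so
    \<open>X\<close> is the zero field there.\<close>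
  have 2: "vector_field_on M (- K) X"
  proof (rule vector_field_on_cong[OF assms _ _ vector_field_on_zero[OF assms]])
    show "open (- K)" using \<open>closed K\<close> by auto
    then show "open (- K)" .
    show "0 = X q" if "q \<in> - K" for q
    proof -
      have "cmap ?c q \<notin> cball (cmap ?c p) r" if "q \<in> cdom ?c"
        using \<open>q \<in> - K\<close> cp(6)[OF that] unfolding K_def by (metis ComplD imageI)
      then show ?thesis using \<phi>(3) by (simp add: X_def)
    qed
  qed
  have "vector_field M X"
    unfolding vector_field_on_def
  proof
    fix d assume d: "d \<in> M"
    let ?h = "(\<lambda>q. tcoord M d q (X q)) \<circ> cinv d"
    have "smooth_on (cmap d ` (cdom d \<inter> cdom ?c) \<union> cmap d ` (cdom d \<inter> - K)) ?h"
      using 1 2 d assms cp(1) \<open>closed K\<close> unfolding vector_field_on_def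
      by (intro smooth_on_Un open_chart_image) auto
    moreover have "cmap d ` (cdom d \<inter> cdom ?c) \<union> cmap d ` (cdom d \<inter> - K) = cmap d ` (cdom d \<inter> UNIV)"
      using Kc by blast
    ultimately show "smooth_on (cmap d ` (cdom d \<inter> UNIV)) ?h" by simp
  qed
  moreover have "X p = v"
    using chart_at(2)[OF assms] \<phi>(2) coord_field_chart_at[OF assms] by (simp add: X_def)
  ultimately show ?thesis by (rule that)
qed

subsection \<open>Affine connections and their pull-backs\<close>

lemma linear_Basis_expansion:
  fixes L :: "'a::euclidean_space \<Rightarrow> 'b::real_vector"
  assumes "linear L"
  shows "(\<Sum>b\<in>Basis. (x \<bullet> b) *\<^sub>R L b) = L x"
proof -
  have "L (\<Sum>b\<in>Basis. (x \<bullet> b) *\<^sub>R b) = (\<Sum>b\<in>Basis. (x \<bullet> b) *\<^sub>R L b)"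
    by (simp add: linear_sum[OF assms] linear_scale[OF assms])
  then show ?thesis by (simp add: euclidean_representation)
qed

lemma bilinear_Basis_expansion:
  fixes B :: "'a::euclidean_space \<Rightarrow> 'b::euclidean_space \<Rightarrow> real"
  assumes "\<And>y. linear (\<lambda>x. B x y)" "\<And>x. linear (B x)"
  shows "(\<Sum>b\<in>Basis. \<Sum>b'\<in>Basis. (x \<bullet> b) * ((y \<bullet> b') * B b b')) = B x y"
proof -
  have "B x y = (\<Sum>b\<in>Basis. (x \<bullet> b) *\<^sub>R B b y)"
    using linear_Basis_expansion[OF assms(1)] by simp
  also have "\<dots> = (\<Sum>b\<in>Basis. (x \<bullet> b) *\<^sub>R (\<Sum>b'\<in>Basis. (y \<bullet> b') *\<^sub>R B b b'))"
    using linear_Basis_expansion[OF assms(2)] by simp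
  finally show ?thesis by (simp add: sum_distrib_left)
qed

lemma
  assumes "affine_connection M D" "open U" "vector_field_on M U Y" "p \<in> U"
  shows conn_add: "vector_field_on M U Z \<Longrightarrow> D p v (\<lambda>q. Y q + Z q) = D p v Y + D p v Z"
    and conn_scaleR: "smooth_fun_on M U h \<Longrightarrow>
      D p v (\<lambda>q. h q *\<^sub>R Y q) = tderiv M p h v *\<^sub>R Y p + h p *\<^sub>R D p v Y"
proof -
  note * = assms(1)[unfolded affine_connection_def, rule_format, OF assms(2,3)]
  show "vector_field_on M U Z \<Longrightarrow> D p v (\<lambda>q. Y q + Z q) = D p v Y + D p v Z"
    using conjunct1[OF conjunct2[OF *]] assms(4) by simp
  show "smooth_fun_on M U h \<Longrightarrow>
      D p v (\<lambda>q. h q *\<^sub>R Y q) = tderiv M p h v *\<^sub>R Y p + h p *\<^sub>R D p v Y"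
    using conjunct1[OF conjunct2[OF conjunct2[OF *]]] assms(4) by simp
qed

text \<open>The indicator function of \<open>U\<close> is smooth on \<open>U\<close>, with value 1
  and derivative 0 at \<open>p\<close>. By the Leibniz rule multiplication by it preserves the
  covariant derivative, while it makes \<open>Y\<close> and \<open>Z\<close> equal as
  functions.\<close>

lemma conn_local:
  assumes "smooth_manifold M" "affine_connection M D" "open U" "p \<in> U"
    and "vector_field_on M U Y" "\<And>q. q \<in> U \<Longrightarrow> Y q = Z q"
  shows "D p v Y = D p v Z"
proof -
  define h where "h q = (if q \<in> U then 1 else 0 :: real)" for q
  have h: "smooth_fun_on M U h"
    unfolding smooth_fun_on_def
  proof
    fix c assume c: "c \<in> M"
    show "smooth_on (cmap c ` (cdom c \<inter> U)) (h \<circ> cinv c)"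
      by (rule smooth_on_cong[THEN iffD1, rotated 2, OF smooth_on_const[of _ 1]])
        (use open_chart_image[OF assms(1) c assms(3)] chart_props(6)[OF assms(1) c] in \<open>auto simp: h_def\<close>)
  qed
  have "tderiv M p h = tderiv M p (\<lambda>q. 1)"
    by (rule tderiv_cong[OF assms(1,3,4)]) (simp add: h_def)
  then have "tderiv M p h v = 0" using has_tderiv_eq[OF has_tderiv_const] by metis
  then have *: "D p v (\<lambda>q. h q *\<^sub>R W q) = D p v W" if "vector_field_on M U W" for W
    using conn_scaleR[OF assms(2,3) that assms(4) h, of v] assms(4) by (simp add: h_def)
  have "(\<lambda>q. h q *\<^sub>R Y q) = (\<lambda>q. h q *\<^sub>R Z q)" using assms(6) by (auto simp: h_def)
  then show ?thesis
    using *[OF assms(5)] *[OF vector_field_on_cong[OF assms(1,3,6,5)]] by simp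
qed

lemma conn_sum_scaleR:
  assumes "smooth_manifold M" "affine_connection M D" "open U" "p \<in> U"
    and "\<And>i. i \<in> I \<Longrightarrow> vector_field_on M U (E i)" "\<And>i. i \<in> I \<Longrightarrow> smooth_fun_on M U (h i)"
  shows "D p v (\<lambda>q. \<Sum>i\<in>I. h i q *\<^sub>R E i q) =
    (\<Sum>i\<in>I. tderiv M p (h i) v *\<^sub>R E i p + h i p *\<^sub>R D p v (E i))"
proof -
  have z: "D p v (\<lambda>q. 0) = 0"
    using conn_add[OF assms(2,3) vector_field_on_zero[OF assms(1,3)] assms(4)
        vector_field_on_zero[OF assms(1,3)], of v] by simp
  show ?thesis
    using assms(5,6)
  proof (induction I rule: infinite_finite_induct)
    case (insert i I)
    have "vector_field_on M U (\<lambda>q. \<Sum>i\<in>I. h i q *\<^sub>R E i q)"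
      using insert.prems by (intro vector_field_on_sum vector_field_on_scaleR assms(1,3)) auto
    then have "D p v (\<lambda>q. h i q *\<^sub>R E i q + (\<Sum>i\<in>I. h i q *\<^sub>R E i q)) =
        D p v (\<lambda>q. h i q *\<^sub>R E i q) + D p v (\<lambda>q. \<Sum>i\<in>I. h i q *\<^sub>R E i q)"
      using insert.prems by (intro conn_add[OF assms(2,3)] vector_field_on_scaleR assms(1,3,4)) auto
    then show ?case
      using insert conn_scaleR[OF assms(2,3) _ assms(4), of "E i" "h i" v] by simp
  qed (simp_all add: z)
qed

text \<open>\<open>coord_field\<close> is known to be linear in \<open>w\<close> at points of the
  chart domain, hence the appeal to \<open>conn_local\<close>. The constant coefficients contribute
  no derivative.\<close>

lemma conn_coord_field_expand:
  assumes "smooth_manifold M" "affine_connection M D" "c \<in> M" "p \<in> cdom c"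
  shows "D p v (coord_field M c w) = (\<Sum>b\<in>Basis. (w \<bullet> b) *\<^sub>R D p v (coord_field M c b))"
proof -
  note cp = chart_props[OF assms(1,3)]
  have "D p v (coord_field M c w) = D p v (\<lambda>q. \<Sum>b\<in>Basis. (w \<bullet> b) *\<^sub>R coord_field M c b q)"
    using linear_Basis_expansion[OF coord_field_linear[OF assms(1,3)]]
    by (intro conn_local[OF assms(1,2) cp(1) assms(4) coord_field_vector_field[OF assms(1,3)]]) simp
  also have "\<dots> = (\<Sum>b\<in>Basis. tderiv M p (\<lambda>q. w \<bullet> b) v *\<^sub>R coord_field M c b p
      + (w \<bullet> b) *\<^sub>R D p v (coord_field M c b))"
    by (intro conn_sum_scaleR[OF assms(1,2) cp(1) assms(4)] coord_field_vector_field[OF assms(1,3)]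
        smooth_fun_on_const)
  finally show ?thesis by (simp add: has_tderiv_eq[OF has_tderiv_const])
qed

lemma conn_coord_field_linear:
  assumes "smooth_manifold M" "affine_connection M D" "c \<in> M" "p \<in> cdom c"
  shows "linear (\<lambda>w. D p v (coord_field M c w))"
proof (rule linearI)
  show "D p v (coord_field M c (w + w')) = D p v (coord_field M c w) + D p v (coord_field M c w')" for w w'
    unfolding conn_coord_field_expand[OF assms, of v "w + w'"] conn_coord_field_expand[OF assms, of v w]
      conn_coord_field_expand[OF assms, of v w']
    by (simp add: inner_add_left scaleR_add_left sum.distrib)
  show "D p v (coord_field M c (k *\<^sub>R w)) = k *\<^sub>R D p v (coord_field M c w)" for k w
    unfolding conn_coord_field_expand[OF assms, of v "k *\<^sub>R w"] conn_coord_field_expand[OF assms, of v w]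
    by (simp add: scaleR_sum_right)
qed

text \<open>The coordinate formula for a connection: derivative of the components plus Christoffel
  part. It lets fields on \<open>N\<close> be compared with fields along \<open>f\<close>, for which
  this formula is the definition.\<close>

lemma conn_chart:
  assumes "smooth_manifold M" "affine_connection M D" "open U" "p \<in> U" "vector_field_on M U W"
  defines "c \<equiv> chart_at M p"
  shows "D p v W = tderiv M p (\<lambda>q. tcoord M c q (W q)) v + D p v (coord_field M c (W p))"
proof -
  note ca = chart_at[OF assms(1), of p, folded c_def]
  note cp = chart_props[OF assms(1) ca(1)]
  let ?h = "\<lambda>q. tcoord M c q (W q)"
  have o: "open (U \<inter> cdom c)" "p \<in> U \<inter> cdom c" using assms(3,4) cp(1) ca(2) by auto
  have W: "vector_field_on M (U \<inter> cdom c) W" using assms(5) by (rule vector_field_on_subset) auto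
  have t: "tdiff M p ?h" by (rule vector_field_on_tdiff[OF assms(1,5,3,4) ca])
  have tb: "tderiv M p (\<lambda>q. ?h q \<bullet> b) v = tderiv M p ?h v \<bullet> b" for b
    by (rule has_tderiv_eq[OF has_tderiv_bounded_linear[OF bounded_linear_inner_left t[unfolded tdiff_def]]])
  have "D p v W = D p v (\<lambda>q. \<Sum>b\<in>Basis. (?h q \<bullet> b) *\<^sub>R coord_field M c b q)"
  proof (rule conn_local[OF assms(1,2) o W])
    fix q assume q: "q \<in> U \<inter> cdom c"
    show "W q = (\<Sum>b\<in>Basis. (?h q \<bullet> b) *\<^sub>R coord_field M c b q)"
      using q linear_Basis_expansion[OF coord_field_linear[OF assms(1) ca(1)], of q "?h q"]
        coord_field_tcoord[OF assms(1) ca(1), of q "W q"] by simp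
  qed
  also have "\<dots> = (\<Sum>b\<in>Basis. tderiv M p (\<lambda>q. ?h q \<bullet> b) v *\<^sub>R coord_field M c b p
      + (?h p \<bullet> b) *\<^sub>R D p v (coord_field M c b))"
    by (intro conn_sum_scaleR[OF assms(1,2) o] vector_field_on_component[OF assms(1) W o(1) ca(1)]
        vector_field_on_subset[OF coord_field_vector_field[OF assms(1) ca(1)]]) auto
  also have "\<dots> = (\<Sum>b\<in>Basis. (tderiv M p ?h v \<bullet> b) *\<^sub>R b) +
      (\<Sum>b\<in>Basis. (W p \<bullet> b) *\<^sub>R D p v (coord_field M c b))"
    unfolding tb using tcoord_chart_at[OF assms(1)] coord_field_chart_at[OF assms(1)]
    by (simp add: sum.distrib c_def)
  finally show ?thesis
    by (simp add: euclidean_representation conn_coord_field_expand[OF assms(1,2) ca, symmetric])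
qed

text \<open>Symmetry of the Christoffel symbols: fields with constant components in one chart have
  zero bracket, and the connection is torsion-free.\<close>

lemma levi_civita_coord_field_symmetric:
  fixes p :: "'m::{t2_space,second_countable_topology}"
  assumes "smooth_manifold M" "levi_civita M g D"
  defines "c \<equiv> chart_at M p"
  shows "D p v (coord_field M c w) = D p w (coord_field M c v)"
proof -
  note ca = chart_at[OF assms(1), of p, folded c_def]
  note cp = chart_props[OF assms(1) ca(1)]
  have t: "tderiv M p (\<lambda>q. tcoord M c q (coord_field M c w q)) v = 0" for w v
  proof -
    have "tderiv M p (\<lambda>q. tcoord M c q (coord_field M c w q)) = tderiv M p (\<lambda>q. w)"
      by (rule tderiv_cong[OF assms(1) cp(1) ca(2)]) (simp add: tcoord_coord_field[OF assms(1) ca(1)])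
    then show ?thesis using has_tderiv_eq[OF has_tderiv_const] by metis
  qed
  have "D p (coord_field M c v p) (coord_field M c w) - D p (coord_field M c w p) (coord_field M c v)
      = lie_bracket M (coord_field M c v) (coord_field M c w) p"
    using assms(2)[unfolded levi_civita_def, THEN conjunct2, THEN conjunct1, rule_format,
        OF cp(1) coord_field_vector_field[OF assms(1) ca(1)] coord_field_vector_field[OF assms(1) ca(1)] ca(2)] .
  then show ?thesis
    using coord_field_chart_at[OF assms(1)] t by (simp add: c_def lie_bracket_def)
qed

section \<open>Covariant differentiation along a map\<close>

text \<open>Differentiability at one point, tested in the chart selected at \<open>f p\<close>, is
  what the component term of \<open>cov_deriv_along\<close> requires.\<close>

definition along_diff ::
  "('m, 'e::euclidean_space) atlas \<Rightarrow> ('b, 'f::euclidean_space) atlas \<Rightarrow> ('m \<Rightarrow> 'b) \<Rightarrow>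
   'm \<Rightarrow> ('m \<Rightarrow> 'f) \<Rightarrow> bool" where
  "along_diff M N f p V \<longleftrightarrow> tdiff M p (\<lambda>q. tcoord N (chart_at N (f p)) (f q) (V q))"

text \<open>Here \<open>g\<close> is the metric of \<open>N\<close>;
  \<open>product_submanifold\<close> renames it to \<open>gt\<close> and keeps \<open>g\<close> for
  the metric of \<open>M\<close>.\<close>

locale pullback_connection =
  fixes M :: "('m::{t2_space,second_countable_topology}, 'e::euclidean_space) atlas"
    and N :: "('b::{t2_space,second_countable_topology}, 'f::euclidean_space) atlas"
    and f :: "'m \<Rightarrow> 'b" and g :: "'b \<Rightarrow> 'f \<Rightarrow> 'f \<Rightarrow> real" and D :: "'b \<Rightarrow> 'f \<Rightarrow> ('b \<Rightarrow> 'f) \<Rightarrow> 'f"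
  assumes M: "smooth_manifold M" and N: "smooth_manifold N" and f: "smooth_map M N f"
    and LC: "levi_civita N g D" and g: "riemannian_metric N g"
begin

abbreviation "cov p v V \<equiv> cov_deriv_along M N f D p v V"
abbreviation "df p v \<equiv> dmap M N f p v"

lemma conn: "affine_connection N D" using LC by (simp add: levi_civita_def)

lemma cont: "continuous_on UNIV f" using f unfolding smooth_map_def by blast

lemma open_chart_preimage: "d \<in> N \<Longrightarrow> open (f -` cdom d)"
  using cont chart_props(1)[OF N] by (simp add: open_vimage)

lemma f_chart_tdiff:
  assumes "d \<in> N" "f p \<in> cdom d"
  shows "tdiff M p (cmap d \<circ> f)"
proof -
  let ?c = "chart_at M p"
  note ca = chart_at[OF M, of p]
  have "smooth_on (cmap ?c ` (cdom ?c \<inter> f -` cdom d)) (cmap d \<circ> f \<circ> cinv ?c)"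
    using f assms ca unfolding smooth_map_def by blast
  from smooth_on_imp_has_derivative[OF this open_chart_image[OF M ca(1) open_chart_preimage[OF assms(1)]],
      of "cmap ?c p"]
  have "has_tderiv M p (cmap d \<circ> f) (frechet_derivative (cmap d \<circ> f \<circ> cinv ?c) (at (cmap ?c p)))"
    using ca assms unfolding has_tderiv_def by simp
  then show ?thesis by (rule has_tderiv_tdiff)
qed

lemma df_has_tderiv: "has_tderiv M p (cmap (chart_at N (f p)) \<circ> f) (df p)"
  using f_chart_tdiff[OF chart_at[OF N]] unfolding tdiff_def dmap_def[abs_def] by simp

lemma df_linear: "linear (df p)"
  by (rule has_tderiv_linear[OF df_has_tderiv])

lemma has_tderiv_compose:
  "has_tderiv N (f p) h E \<Longrightarrow> has_tderiv M p (\<lambda>q. h (f q)) (\<lambda>v. E (df p v))"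
  by (rule has_tderiv_chain[OF M N cont _ df_has_tderiv])

lemma tcoord_df:
  assumes "d \<in> N" "f q \<in> cdom d"
  shows "tcoord N d (f q) (df q v) = tderiv M q (cmap d \<circ> f) v"
  using has_tderiv_eq[OF has_tderiv_compose[OF has_tderiv_cmap[OF N assms]], of v] by (simp add: o_def)

lemma along_diff_vector_field_along:
  assumes "vector_field_along M N f V"
  shows "along_diff M N f p V"
proof -
  let ?c = "chart_at M p" and ?d = "chart_at N (f p)"
  note ca = chart_at[OF M, of p] and da = chart_at[OF N, of "f p"]
  let ?h = "(\<lambda>q. tcoord N ?d (f q) (V q)) \<circ> cinv ?c"
  have "smooth_on (cmap ?c ` (cdom ?c \<inter> f -` cdom ?d)) ?h"
    using assms ca da unfolding vector_field_along_def by blast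
  from smooth_on_imp_has_derivative[OF this open_chart_image[OF M ca(1) open_chart_preimage[OF da(1)]],
      of "cmap ?c p"]
  have "has_tderiv M p (\<lambda>q. tcoord N ?d (f q) (V q)) (frechet_derivative ?h (at (cmap ?c p)))"
    using ca da unfolding has_tderiv_def by simp
  then show ?thesis unfolding along_diff_def by (rule has_tderiv_tdiff)
qed

lemma cov_eqI:
  assumes "has_tderiv M p (\<lambda>q. tcoord N (chart_at N (f p)) (f q) (V q)) E"
  shows "cov p v V = E v + D (f p) (df p v) (coord_field N (chart_at N (f p)) (V p))"
  using has_tderiv_eq[OF assms] by (simp add: cov_deriv_along_def Let_def)

lemma cov_add:
  assumes "along_diff M N f p V" "along_diff M N f p W"
  shows "along_diff M N f p (\<lambda>q. V q + W q)" "cov p v (\<lambda>q. V q + W q) = cov p v V + cov p v W"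
proof -
  let ?d = "chart_at N (f p)"
  let ?h = "\<lambda>V q. tcoord N ?d (f q) (V q)"
  note da = chart_at[OF N, of "f p"]
  note VW = assms[unfolded along_diff_def tdiff_def]
  have h: "has_tderiv M p (?h (\<lambda>q. V q + W q)) (\<lambda>v. tderiv M p (?h V) v + tderiv M p (?h W) v)"
    by (rule has_tderiv_cong[OF M open_chart_preimage[OF da(1)] _ _ has_tderiv_add[OF VW]])
      (use da(2) in \<open>auto simp: linear_add[OF tcoord_linear[OF N da(1)]]\<close>)
  then show "along_diff M N f p (\<lambda>q. V q + W q)"
    unfolding along_diff_def by (rule has_tderiv_tdiff)
  show "cov p v (\<lambda>q. V q + W q) = cov p v V + cov p v W"
    unfolding cov_eqI[OF h] cov_eqI[OF VW(1)] cov_eqI[OF VW(2)]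
    by (simp add: linear_add[OF conn_coord_field_linear[OF N conn da]])
qed

lemma cov_scaleR:
  assumes "along_diff M N f p V" "tdiff M p h"
  shows "along_diff M N f p (\<lambda>q. h q *\<^sub>R V q)"
    "cov p v (\<lambda>q. h q *\<^sub>R V q) = tderiv M p h v *\<^sub>R V p + h p *\<^sub>R cov p v V"
proof -
  let ?d = "chart_at N (f p)"
  let ?h = "\<lambda>V q. tcoord N ?d (f q) (V q)"
  note da = chart_at[OF N, of "f p"]
  note V = assms(1)[unfolded along_diff_def tdiff_def]
  have h: "has_tderiv M p (?h (\<lambda>q. h q *\<^sub>R V q))
      (\<lambda>v. h p *\<^sub>R tderiv M p (?h V) v + tderiv M p h v *\<^sub>R ?h V p)"
    by (rule has_tderiv_cong[OF M open_chart_preimage[OF da(1)] _ _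
          has_tderiv_bilinear[OF M bounded_bilinear_scaleR assms(2)[unfolded tdiff_def] V]])
      (use da(2) in \<open>auto simp: linear_scale[OF tcoord_linear[OF N da(1)]]\<close>)
  then show "along_diff M N f p (\<lambda>q. h q *\<^sub>R V q)"
    unfolding along_diff_def by (rule has_tderiv_tdiff)
  show "cov p v (\<lambda>q. h q *\<^sub>R V q) = tderiv M p h v *\<^sub>R V p + h p *\<^sub>R cov p v V"
    unfolding cov_eqI[OF h] cov_eqI[OF V]
    by (simp add: linear_scale[OF conn_coord_field_linear[OF N conn da]] tcoord_chart_at[OF N]
        algebra_simps)
qed

lemma cov_zero: "along_diff M N f p (\<lambda>q. 0)" "cov p v (\<lambda>q. 0) = 0"
proof -
  note da = chart_at[OF N, of "f p"]
  have h: "has_tderiv M p (\<lambda>q. tcoord N (chart_at N (f p)) (f q) 0) (\<lambda>v. 0)"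
    by (rule has_tderiv_cong[OF M open_chart_preimage[OF da(1)] _ _ has_tderiv_const[where k = 0]])
      (use da(2) in \<open>auto simp: linear_0[OF tcoord_linear[OF N da(1)]]\<close>)
  then show "along_diff M N f p (\<lambda>q. 0)" unfolding along_diff_def by (rule has_tderiv_tdiff)
  show "cov p v (\<lambda>q. 0) = 0"
    unfolding cov_eqI[OF h] by (simp add: linear_0[OF conn_coord_field_linear[OF N conn da]])
qed

lemma cov_sum:
  assumes "\<And>i. i \<in> I \<Longrightarrow> along_diff M N f p (V i)"
  shows "along_diff M N f p (\<lambda>q. \<Sum>i\<in>I. V i q) \<and>
    cov p v (\<lambda>q. \<Sum>i\<in>I. V i q) = (\<Sum>i\<in>I. cov p v (V i))"
  using assms by (induction I rule: infinite_finite_induct) (simp_all add: cov_zero cov_add)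

text \<open>Parallelism of \<open>J\<close> is given for fields on \<open>N\<close>, whereas
  \<open>V\<close> is a field along \<open>f\<close>. When \<open>V\<close> is expanded in
  coordinate fields, the derivative of its components passes through the linear map
  \<open>J (f p)\<close>. What is left concerns the field on \<open>N\<close> with constant
  components \<open>V p\<close>, to which parallelism applies.\<close>

lemma cov_parallel:
  assumes "along_diff M N f p V" "tensor11 N J"
    and "\<And>U Y p v. open U \<Longrightarrow> vector_field_on N U Y \<Longrightarrow> p \<in> U \<Longrightarrow>
      D p v (\<lambda>q. J q (Y q)) = J p (D p v Y)"
  shows "cov p v (\<lambda>q. J (f q) (V q)) = J (f p) (cov p v V)"
proof -
  let ?d = "chart_at N (f p)"
  let ?E = "coord_field N ?d"
  let ?h = "\<lambda>q. tcoord N ?d (f q) (V q)"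
  define JE where "JE w y = tcoord N ?d y (J y (?E w y))" for w y
  note da = chart_at[OF N, of "f p"]
  note dp = chart_props[OF N da(1)]
  note V = assms(1)[unfolded along_diff_def tdiff_def]
  have J: "linear (J y)" for y using assms(2) unfolding tensor11_def by blast
  have vf: "vector_field_on N (cdom ?d) (\<lambda>y. J y (?E w y))" for w
    using assms(2) dp(1) coord_field_vector_field[OF N da(1)] unfolding tensor11_def by blast
  have tJ: "has_tderiv N (f p) (JE w) (tderiv N (f p) (JE w))" for w
    using vector_field_on_tdiff[OF N vf dp(1) da(2) da] unfolding tdiff_def JE_def[abs_def] .
  have lin: "linear (\<lambda>w. JE w y)" if "y \<in> cdom ?d" for y
    using linear_compose[OF linear_compose[OF coord_field_linear[OF N da(1) that] J]
        tcoord_linear[OF N da(1) that]] by (simp add: o_def JE_def)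
  have JE0: "JE w (f p) = J (f p) w" for w
    by (simp add: JE_def tcoord_chart_at[OF N] coord_field_chart_at[OF N])
  have "has_tderiv M p (\<lambda>q. \<Sum>b\<in>Basis. (?h q \<bullet> b) *\<^sub>R JE b (f q))
    (\<lambda>v. \<Sum>b\<in>Basis. (?h p \<bullet> b) *\<^sub>R tderiv N (f p) (JE b) (df p v) + (tderiv M p ?h v \<bullet> b) *\<^sub>R JE b (f p))"
    by (intro has_tderiv_sum has_tderiv_bilinear[OF M bounded_bilinear_scaleR] has_tderiv_compose tJ
        has_tderiv_bounded_linear[OF bounded_linear_inner_left V])
  then have "has_tderiv M p (\<lambda>q. tcoord N ?d (f q) (J (f q) (V q)))
    (\<lambda>v. \<Sum>b\<in>Basis. (?h p \<bullet> b) *\<^sub>R tderiv N (f p) (JE b) (df p v) + (tderiv M p ?h v \<bullet> b) *\<^sub>R JE b (f p))"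
  proof (rule has_tderiv_cong[OF M open_chart_preimage[OF da(1)], rotated -1])
    show "p \<in> f -` cdom ?d" using da(2) by simp
    show "(\<Sum>b\<in>Basis. (?h q \<bullet> b) *\<^sub>R JE b (f q)) = tcoord N ?d (f q) (J (f q) (V q))"
      if "q \<in> f -` cdom ?d" for q
      using that linear_Basis_expansion[OF lin, of "f q" "?h q"] coord_field_tcoord[OF N da(1), of "f q" "V q"]
      by (simp add: JE_def)
  qed
  from cov_eqI[OF this, of v]
  have 1: "cov p v (\<lambda>q. J (f q) (V q)) = (\<Sum>b\<in>Basis. (V p \<bullet> b) *\<^sub>R tderiv N (f p) (JE b) (df p v))
     + J (f p) (tderiv M p ?h v) + D (f p) (df p v) (?E (J (f p) (V p)))"
    by (simp add: JE0 sum.distrib tcoord_chart_at[OF N] linear_Basis_expansion[OF J])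
  have "tderiv N (f p) (JE (V p)) (df p v) = (\<Sum>b\<in>Basis. (V p \<bullet> b) *\<^sub>R tderiv N (f p) (JE b) (df p v))"
  proof (rule has_tderiv_eq[where v = "df p v"])
    show "has_tderiv N (f p) (JE (V p)) (\<lambda>v. \<Sum>b\<in>Basis. (V p \<bullet> b) *\<^sub>R tderiv N (f p) (JE b) v)"
      by (rule has_tderiv_cong[OF N dp(1) da(2) _ has_tderiv_sum[OF
              has_tderiv_bounded_linear[OF bounded_linear_scaleR_right tJ]]])
        (simp add: linear_Basis_expansion[OF lin])
  qed
  then have "D (f p) (df p v) (\<lambda>y. J y (?E (V p) y)) =
      (\<Sum>b\<in>Basis. (V p \<bullet> b) *\<^sub>R tderiv N (f p) (JE b) (df p v)) + D (f p) (df p v) (?E (J (f p) (V p)))"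
    using conn_chart[OF N conn dp(1) da(2) vf, of "df p v" "V p"]
    by (simp add: JE_def[abs_def] coord_field_chart_at[OF N])
  moreover have "D (f p) (df p v) (\<lambda>y. J y (?E (V p) y)) = J (f p) (D (f p) (df p v) (?E (V p)))"
    by (rule assms(3)[OF dp(1) coord_field_vector_field[OF N da(1)] da(2)])
  ultimately show ?thesis
    unfolding 1 cov_eqI[OF V] by (simp add: linear_add[OF J] algebra_simps)
qed

text \<open>Express the inner product through the Gram matrix \<open>G\<close> of the coordinate
  fields. The product rule differentiates components and \<open>G\<close>, and metric compatibility
  on \<open>N\<close> turns the derivative of \<open>G\<close> into the Christoffel parts of the two
  covariant derivatives.\<close>

lemma cov_metric:
  assumes "along_diff M N f p V" "along_diff M N f p W"
  shows "tderiv M p (\<lambda>q. g (f q) (V q) (W q)) v = g (f p) (cov p v V) (W p) + g (f p) (V p) (cov p v W)"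
proof -
  let ?d = "chart_at N (f p)"
  let ?E = "coord_field N ?d"
  let ?h = "\<lambda>V q. tcoord N ?d (f q) (V q)"
  define G where "G b b' y = g y (?E b y) (?E b' y)" for b b' y
  define \<Gamma> where "\<Gamma> w = D (f p) (df p v) (?E w)" for w
  note da = chart_at[OF N, of "f p"]
  note dp = chart_props[OF N da(1)]
  note V = assms(1)[unfolded along_diff_def tdiff_def] and W = assms(2)[unfolded along_diff_def tdiff_def]
  have gl: "linear (\<lambda>x. g y x z)" "linear (g y z)" for y z
    using g unfolding riemannian_metric_def bilinear_def by blast+
  have \<Gamma>: "linear \<Gamma>"
    unfolding \<Gamma>_def[abs_def] by (rule conn_coord_field_linear[OF N conn da])
  have vf: "vector_field_on N (cdom ?d) (?E w)" for w by (rule coord_field_vector_field[OF N da(1)])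
  have "smooth_fun_on N (cdom ?d) (G b b')" for b b'
    unfolding G_def[abs_def]
    by (rule g[unfolded riemannian_metric_def, THEN conjunct2, rule_format, OF dp(1) vf vf])
  then have tG: "has_tderiv N (f p) (G b b') (tderiv N (f p) (G b b'))" for b b'
    unfolding tdiff_def[symmetric] by (rule smooth_fun_on_tdiff[OF N _ dp(1) da(2)])
  have dG: "tderiv N (f p) (G b b') (df p v) = g (f p) (\<Gamma> b) b' + g (f p) b (\<Gamma> b')" for b b'
    using LC[unfolded levi_civita_def, THEN conjunct2, THEN conjunct2, rule_format,
        OF dp(1) vf vf da(2), of b b' "df p v"]
    by (simp add: G_def[abs_def] \<Gamma>_def coord_field_chart_at[OF N])
  have G0: "G b b' (f p) = g (f p) b b'" for b b'
    by (simp add: G_def coord_field_chart_at[OF N])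
  have "has_tderiv M p (\<lambda>q. \<Sum>b\<in>Basis. \<Sum>b'\<in>Basis. (?h V q \<bullet> b) * ((?h W q \<bullet> b') * G b b' (f q)))
    (\<lambda>v. \<Sum>b\<in>Basis. \<Sum>b'\<in>Basis. (?h V p \<bullet> b) * ((?h W p \<bullet> b') * tderiv N (f p) (G b b') (df p v)
         + (tderiv M p (?h W) v \<bullet> b') * G b b' (f p))
       + (tderiv M p (?h V) v \<bullet> b) * ((?h W p \<bullet> b') * G b b' (f p)))"
    by (intro has_tderiv_sum has_tderiv_bilinear[OF M bounded_bilinear_mult] has_tderiv_compose tG
        has_tderiv_bounded_linear[OF bounded_linear_inner_left V]
        has_tderiv_bounded_linear[OF bounded_linear_inner_left W])
  then have "has_tderiv M p (\<lambda>q. g (f q) (V q) (W q))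
    (\<lambda>v. \<Sum>b\<in>Basis. \<Sum>b'\<in>Basis. (?h V p \<bullet> b) * ((?h W p \<bullet> b') * tderiv N (f p) (G b b') (df p v)
         + (tderiv M p (?h W) v \<bullet> b') * G b b' (f p))
       + (tderiv M p (?h V) v \<bullet> b) * ((?h W p \<bullet> b') * G b b' (f p)))"
  proof (rule has_tderiv_cong[OF M open_chart_preimage[OF da(1)], rotated -1])
    show "p \<in> f -` cdom ?d" using da(2) by simp
    fix q assume "q \<in> f -` cdom ?d"
    then have q: "f q \<in> cdom ?d" by simp
    note El = coord_field_linear[OF N da(1) q]
    have "linear (\<lambda>x. g (f q) (?E x (f q)) (?E z (f q)))"
      "linear (\<lambda>x. g (f q) (?E z (f q)) (?E x (f q)))" for z
      using linear_compose[OF El gl(1)] linear_compose[OF El gl(2)] by (simp_all add: o_def)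
    from bilinear_Basis_expansion[of "\<lambda>x z. g (f q) (?E x (f q)) (?E z (f q))", OF this]
    show "(\<Sum>b\<in>Basis. \<Sum>b'\<in>Basis. (?h V q \<bullet> b) * ((?h W q \<bullet> b') * G b b' (f q))) = g (f q) (V q) (W q)"
      by (simp add: G_def coord_field_tcoord[OF N da(1) q])
  qed
  from has_tderiv_eq[OF this, of v]
  \<comment> \<open>The four sums are the Christoffel terms of \<open>V\<close> and of
    \<open>W\<close>, then the component derivatives of \<open>W\<close> and of
    \<open>V\<close>.\<close>
  have "tderiv M p (\<lambda>q. g (f q) (V q) (W q)) v =
      (\<Sum>b\<in>Basis. \<Sum>b'\<in>Basis. (V p \<bullet> b) * ((W p \<bullet> b') * g (f p) (\<Gamma> b) b'))
      + (\<Sum>b\<in>Basis. \<Sum>b'\<in>Basis. (V p \<bullet> b) * ((W p \<bullet> b') * g (f p) b (\<Gamma> b')))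
      + (\<Sum>b\<in>Basis. \<Sum>b'\<in>Basis. (V p \<bullet> b) * ((tderiv M p (?h W) v \<bullet> b') * g (f p) b b'))
      + (\<Sum>b\<in>Basis. \<Sum>b'\<in>Basis. (tderiv M p (?h V) v \<bullet> b) * ((W p \<bullet> b') * g (f p) b b'))"
    by (simp add: tcoord_chart_at[OF N] dG G0 sum.distrib distrib_left)
  also have "\<dots> = g (f p) (\<Gamma> (V p)) (W p) + g (f p) (V p) (\<Gamma> (W p)) + g (f p) (V p) (tderiv M p (?h W) v)
      + g (f p) (tderiv M p (?h V) v) (W p)"
    using bilinear_Basis_expansion[of "\<lambda>x y. g (f p) (\<Gamma> x) y" "V p" "W p"]
      bilinear_Basis_expansion[of "\<lambda>x y. g (f p) x (\<Gamma> y)" "V p" "W p"]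
      bilinear_Basis_expansion[of "g (f p)"]
      linear_compose[OF \<Gamma> gl(1)] linear_compose[OF \<Gamma> gl(2)] gl by (simp add: o_def)
  finally show ?thesis
    unfolding cov_eqI[OF V] cov_eqI[OF W] \<Gamma>_def[symmetric]
    by (simp add: linear_add[OF gl(1)] linear_add[OF gl(2)])
qed

section \<open>Push-forward of vector fields\<close>

text \<open>In charts the push-forward is the derivative of the local expression of \<open>f\<close>
  applied to the components of \<open>Y\<close>. The product rule gives its second derivative,
  expanded over \<open>Basis\<close>, plus \<open>df\<close> of the derivative of the
  components.\<close>

lemma push_has_tderiv:
  fixes p :: 'm
  assumes "vector_field M Y"
  defines "d \<equiv> chart_at N (f p)" and "c \<equiv> chart_at M p"
  shows "has_tderiv M p (\<lambda>q. tcoord N d (f q) (df q (Y q)))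
    (\<lambda>v. (\<Sum>b\<in>Basis. (Y p \<bullet> b) *\<^sub>R frechet_derivative
        (\<lambda>x. frechet_derivative (cmap d \<circ> f \<circ> cinv c) (at x) b) (at (cmap c p)) v)
      + df p (tderiv M p (\<lambda>q. tcoord M c q (Y q)) v))"
proof -
  note ca = chart_at[OF M, of p, folded c_def] and da = chart_at[OF N, of "f p", folded d_def]
  note cp = chart_props[OF M ca(1)]
  define F where "F = cmap d \<circ> f \<circ> cinv c"
  define Fd where "Fd b x = frechet_derivative F (at x) b" for b x
  let ?S = "cmap c ` (cdom c \<inter> f -` cdom d)"
  let ?h = "\<lambda>q. tcoord M c q (Y q)"
  have o: "open ?S" by (intro open_chart_image[OF M ca(1)] open_chart_preimage da)
  have pS: "cmap c p \<in> ?S" using ca da by auto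
  have F: "smooth_on ?S F" using f ca(1) da(1) unfolding smooth_map_def F_def by blast
  have Y: "has_tderiv M p ?h (tderiv M p ?h)"
    using vector_field_on_tdiff[OF M assms(1) open_UNIV UNIV_I ca] unfolding tdiff_def .
  have tc: "tcoord M c p v = v" for v unfolding c_def by (rule tcoord_chart_at[OF M])
  have Fd: "has_tderiv M p (\<lambda>q. Fd b (cmap c q)) (frechet_derivative (Fd b) (at (cmap c p)))" for b
  proof -
    have "(Fd b has_derivative frechet_derivative (Fd b) (at (cmap c p))) (at (cmap c p))"
      unfolding Fd_def[abs_def]
      by (rule smooth_on_imp_has_derivative[OF smooth_on_frechet_derivative[OF F] o pS])
    then have "((\<lambda>q. Fd b (cmap c q)) \<circ> cinv c has_derivative frechet_derivative (Fd b) (at (cmap c p)))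
        (at (cmap c p))"
      by (rule has_derivative_transform_within_open[OF _ o pS]) (auto simp: cp(6))
    from has_tderiv_chart[OF M ca this] show ?thesis by (simp add: tc)
  qed
  \<comment> \<open>The charts are those selected at \<open>p\<close> and \<open>f p\<close>, but
    the formula is needed at all nearby \<open>q\<close> because it is differentiated next.\<close>
  have *: "tcoord N d (f q) (df q v) = (\<Sum>b\<in>Basis. (tcoord M c q v \<bullet> b) *\<^sub>R Fd b (cmap c q))"
    if "q \<in> cdom c" "f q \<in> cdom d" for q v
  proof -
    have "(F has_derivative frechet_derivative F (at (cmap c q))) (at (cmap c q))"
      by (rule smooth_on_imp_has_derivative[OF F o]) (use that in auto)
    from linear_Basis_expansion[OF has_derivative_linear[OF this]]
    show ?thesis
      using tcoord_df[OF da(1) that(2)] tderiv_chart(1)[OF M ca(1) that(1) f_chart_tdiff[OF da(1) that(2)]]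
      by (simp add: Fd_def F_def)
  qed
  have "has_tderiv M p (\<lambda>q. \<Sum>b\<in>Basis. (?h q \<bullet> b) *\<^sub>R Fd b (cmap c q))
      (\<lambda>v. \<Sum>b\<in>Basis. (?h p \<bullet> b) *\<^sub>R frechet_derivative (Fd b) (at (cmap c p)) v
        + (tderiv M p ?h v \<bullet> b) *\<^sub>R Fd b (cmap c p))"
    by (intro has_tderiv_sum has_tderiv_bilinear[OF M bounded_bilinear_scaleR] Fd
        has_tderiv_bounded_linear[OF bounded_linear_inner_left Y])
  then have "has_tderiv M p (\<lambda>q. tcoord N d (f q) (df q (Y q)))
      (\<lambda>v. \<Sum>b\<in>Basis. (?h p \<bullet> b) *\<^sub>R frechet_derivative (Fd b) (at (cmap c p)) v
        + (tderiv M p ?h v \<bullet> b) *\<^sub>R Fd b (cmap c p))"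
    by (rule has_tderiv_cong[OF M open_Int[OF cp(1) open_chart_preimage[OF da(1)]], rotated -1])
      (use ca da in \<open>auto simp: *\<close>)
  moreover have "(\<Sum>b\<in>Basis. (w \<bullet> b) *\<^sub>R Fd b (cmap c p)) = df p w" for w
    using *[OF ca(2) da(2), of w] tcoord_chart_at[OF N, of "f p"] by (simp add: tc d_def)
  ultimately show ?thesis
    by (simp add: sum.distrib tc Fd_def[abs_def] F_def)
qed

lemma push_along_diff: "vector_field M Y \<Longrightarrow> along_diff M N f p (\<lambda>q. df q (Y q))"
  unfolding along_diff_def by (rule has_tderiv_tdiff[OF push_has_tderiv])

text \<open>Antisymmetrising removes the second derivatives of \<open>f\<close> by Schwarz's theorem
  and the Christoffel terms by their symmetry. What remains is \<open>df\<close> of the coordinate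
  expression of the bracket.\<close>

lemma cov_torsion_free:
  assumes "vector_field M X" "vector_field M Y"
  shows "cov p (X p) (\<lambda>q. df q (Y q)) - cov p (Y p) (\<lambda>q. df q (X q)) = df p (lie_bracket M X Y p)"
proof -
  let ?c = "chart_at M p" and ?d = "chart_at N (f p)"
  note ca = chart_at[OF M, of p] and da = chart_at[OF N, of "f p"]
  let ?F = "cmap ?d \<circ> f \<circ> cinv ?c"
  let ?S = "cmap ?c ` (cdom ?c \<inter> f -` cdom ?d)"
  define H where "H b v = frechet_derivative (\<lambda>x. frechet_derivative ?F (at x) b) (at (cmap ?c p)) v" for b v
  have o: "open ?S" by (intro open_chart_image[OF M ca(1)] open_chart_preimage da)
  have pS: "cmap ?c p \<in> ?S" using ca da by auto
  have F: "smooth_on ?S ?F" using f ca(1) da(1) unfolding smooth_map_def by blast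
  have sym: "H b v = H v b" for b v
    unfolding H_def by (rule frechet_derivative_symmetric[OF F o pS])
  have lin: "linear (H b)" for b
    unfolding H_def[abs_def]
    by (rule has_derivative_linear[OF smooth_on_imp_has_derivative[OF smooth_on_frechet_derivative[OF F] o pS]])
  have "(\<lambda>b. H b v) = H v" for v using sym by (rule ext)
  then have lin': "linear (\<lambda>b. H b v)" for v using lin by simp
  have S: "(\<Sum>b\<in>Basis. (w \<bullet> b) *\<^sub>R H b v) = H w v" for v w
    by (rule linear_Basis_expansion[OF lin'])
  have c: "cov p v (\<lambda>q. df q (Z q)) = H (Z p) v + df p (tderiv M p (\<lambda>q. tcoord M ?c q (Z q)) v)
      + D (f p) (df p v) (coord_field N ?d (df p (Z p)))" if "vector_field M Z" for Z v
    using cov_eqI[OF push_has_tderiv[OF that], of p v] S[unfolded H_def] by (simp add: H_def)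
  show ?thesis
    unfolding c[OF assms(1)] c[OF assms(2)] sym[of "X p"] lie_bracket_def
    using levi_civita_coord_field_symmetric[OF N LC, of "f p" "df p (X p)" "df p (Y p)"]
    by (simp add: linear_diff[OF df_linear])
qed

end

subsection \<open>Submanifolds of locally product manifolds\<close>

text \<open>The algebraic core, applied in one tangent space with \<open>G = g p\<close> and
  \<open>B\<close> the commutators of \<open>P\<close> with the Weingarten operators. Hypothesis
  \<open>S\<close> is then pointwise normality.\<close>

lemma antisymmetric_operators_vanish:
  fixes B :: "'r::finite \<Rightarrow> 'a::real_vector \<Rightarrow> 'a" and u :: "'r \<Rightarrow> 'a \<Rightarrow> real"
  assumes G: "bilinear G" "\<And>v w. G v w = G w v" "\<And>v. v \<noteq> 0 \<Longrightarrow> G v v > (0::real)"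
    and anti: "\<And>\<alpha> v w. G (B \<alpha> v) w = - G v (B \<alpha> w)"
    and S: "\<And>v w. (\<Sum>\<alpha>\<in>UNIV. u \<alpha> v *\<^sub>R B \<alpha> w) = (\<Sum>\<alpha>\<in>UNIV. u \<alpha> w *\<^sub>R B \<alpha> v)"
    and e: "\<And>\<alpha> \<beta>. u \<alpha> (e \<beta>) = (if \<alpha> = \<beta> then 1 else 0)"
  shows "B \<alpha> v = 0"
proof -
  have Gl: "linear (\<lambda>x. G x y)" for y using G(1) unfolding bilinear_def by blast
  \<comment> \<open>Setting the second argument in \<open>S\<close> to \<open>e \<beta>\<close>
    leaves a single term on one side.\<close>
  have B: "B \<beta> v = (\<Sum>\<alpha>\<in>UNIV. u \<alpha> v *\<^sub>R B \<alpha> (e \<beta>))" for \<beta> v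
    unfolding S[of v "e \<beta>"] e by (simp add: if_distrib[of "\<lambda>c. c *\<^sub>R _"] cong: if_cong)
  have C: "B \<beta> (e \<gamma>) = B \<gamma> (e \<beta>)" for \<beta> \<gamma>
    by (subst B) (simp add: e if_distrib[of "\<lambda>c. c *\<^sub>R _"] cong: if_cong)
  define T where "T \<alpha> \<beta> \<gamma> = G (B \<alpha> (e \<beta>)) (e \<gamma>)" for \<alpha> \<beta> \<gamma>
  have sym: "T \<alpha> \<beta> \<gamma> = T \<beta> \<alpha> \<gamma>" for \<alpha> \<beta> \<gamma> by (simp add: T_def C[of \<alpha>])
  have alt: "T \<alpha> \<beta> \<gamma> = - T \<alpha> \<gamma> \<beta>" for \<alpha> \<beta> \<gamma>
    using anti[of \<alpha> "e \<beta>" "e \<gamma>"] G(2) by (simp add: T_def)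
  \<comment> \<open>A trilinear array that is symmetric in the first two and alternating in the last two
    indices is zero.\<close>
  have T: "T \<alpha> \<beta> \<gamma> = 0" for \<alpha> \<beta> \<gamma>
    using alt[of \<alpha> \<beta> \<gamma>] sym[of \<alpha> \<gamma> \<beta>] alt[of \<gamma> \<alpha> \<beta>] sym[of \<gamma> \<beta> \<alpha>] alt[of \<beta> \<gamma> \<alpha>] sym[of \<alpha> \<beta> \<gamma>]
    by linarith
  \<comment> \<open>Vanishing of \<open>T\<close> only makes this vector orthogonal to all
    \<open>e\<close>, which need not span. Skew-symmetry and the expansion \<open>B\<close>
    therefore rewrite its squared length as a combination of values of \<open>T\<close>.\<close>
  have Be: "B \<beta> (e \<gamma>) = 0" for \<beta> \<gamma>
  proof (rule ccontr)
    let ?y = "B \<beta> (e \<gamma>)"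
    assume "?y \<noteq> 0"
    then have "0 < G ?y ?y" by (rule G(3))
    also have "G ?y ?y = - G (B \<beta> ?y) (e \<gamma>)" using anti[of \<beta> "e \<gamma>" ?y] G(2) by simp
    also have "G (B \<beta> ?y) (e \<gamma>) = (\<Sum>\<alpha>\<in>UNIV. u \<alpha> ?y * T \<alpha> \<beta> \<gamma>)"
      by (subst B) (simp add: linear_sum[OF Gl] linear_scale[OF Gl] T_def)
    finally show False by (simp add: T)
  qed
  show ?thesis by (subst B) (simp add: Be)
qed

text \<open>The vanishing normal connection is built in: the zero function stands for the forms
  \<open>l\<close>, so the derivative of each \<open>nu \<alpha>\<close> is tangential.\<close>

locale product_submanifold = pullback_connection M N f gt D
  for M :: "('m::{t2_space,second_countable_topology}, 'e::euclidean_space) atlas"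
    and N :: "('b::{t2_space,second_countable_topology}, 'f::euclidean_space) atlas"
    and f gt D +
  fixes g :: "'m \<Rightarrow> 'e \<Rightarrow> 'e \<Rightarrow> real" and J :: "'b \<Rightarrow> 'f \<Rightarrow> 'f"
    and nu :: "'r::finite \<Rightarrow> 'm \<Rightarrow> 'f"
    and P :: "'m \<Rightarrow> 'e \<Rightarrow> 'e" and u :: "'r \<Rightarrow> 'm \<Rightarrow> 'e \<Rightarrow> real" and \<xi> :: "'r \<Rightarrow> 'm \<Rightarrow> 'e"
    and a :: "'m \<Rightarrow> real^'r^'r" and A :: "'r \<Rightarrow> 'm \<Rightarrow> 'e \<Rightarrow> 'e"
  assumes lpr: "locally_product_riemannian N gt D J"
    and imm: "isometric_immersion M g N gt f"
    and frame: "orthonormal_normal_frame M N gt f nu"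
    and ind: "induced_structure M N J f nu P u \<xi> a"
    and wein: "weingarten M N D f nu A (\<lambda>_ _ _ _. 0)"
begin

section \<open>Algebra of the induced structure\<close>

definition normal :: "'m \<Rightarrow> ('r \<Rightarrow> real) \<Rightarrow> 'f" where
  "normal p x = (\<Sum>\<alpha>\<in>UNIV. x \<alpha> *\<^sub>R nu \<alpha> p)"

text \<open>The operator \<open>B\<^sub>\<alpha>\<close> of the introductory idea.\<close>

definition commutator :: "'r \<Rightarrow> 'm \<Rightarrow> 'e \<Rightarrow> 'e" where
  "commutator \<alpha> p v = P p (A \<alpha> p v) - A \<alpha> p (P p v)"

lemma normal_add: "normal p x + normal p y = normal p (\<lambda>\<alpha>. x \<alpha> + y \<alpha>)"
  by (simp add: normal_def scaleR_add_left sum.distrib)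

lemma normal_diff: "normal p x - normal p y = normal p (\<lambda>\<alpha>. x \<alpha> - y \<alpha>)"
  by (simp add: normal_def scaleR_diff_left sum_subtractf)

lemma gt_linear: "linear (\<lambda>x. gt y x z)" "linear (gt y z)"
  using g unfolding riemannian_metric_def bilinear_def by blast+

lemma gt_sym: "gt y v w = gt y w v"
  using g unfolding riemannian_metric_def by blast

lemma g_df: "g p v w = gt (f p) (df p v) (df p w)"
  using imm unfolding isometric_immersion_def by blast

lemma df_inj: "df p v = df p w \<Longrightarrow> v = w"
  using imm unfolding isometric_immersion_def by (simp add: inj_eq)

lemma J_linear: "linear (J y)" and J_tensor: "tensor11 N J"
  and J_J: "J y (J y x) = x" and gt_J_J: "gt y (J y x) (J y z) = gt y x z"
  using lpr unfolding locally_product_riemannian_def almost_product_riemannian_def tensor11_def by auto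

text \<open>An isometry that is its own inverse is self-adjoint.\<close>

lemma J_symmetric: "gt y (J y x) z = gt y x (J y z)"
  using gt_J_J[of y "J y x" z] by (simp add: J_J)

lemma J_parallel:
  assumes "open U" "vector_field_on N U Y" "y \<in> U"
  shows "D y v (\<lambda>q. J q (Y q)) = J y (D y v Y)"
  using lpr[unfolded locally_product_riemannian_def, THEN conjunct2, THEN conjunct2, rule_format,
      OF assms, of v] by simp

lemma P_linear: "linear (P p)"
  and P_vector_field: "vector_field M X \<Longrightarrow> vector_field M (\<lambda>q. P q (X q))"
  using ind unfolding induced_structure_def tensor11_def by auto

lemma u_linear: "linear (u \<alpha> p)"
  and u_smooth: "vector_field M X \<Longrightarrow> smooth_fun_on M UNIV (\<lambda>p. u \<alpha> p (X p))"
  using ind unfolding induced_structure_def one_form_def by auto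

lemma u_tdiff: "vector_field M X \<Longrightarrow> tdiff M p (\<lambda>q. u \<alpha> q (X q))"
  by (rule smooth_fun_on_tdiff[OF M u_smooth open_UNIV UNIV_I])

lemma J_df: "J (f p) (df p v) = df p (P p v) + normal p (\<lambda>\<alpha>. u \<alpha> p v)"
  using ind unfolding induced_structure_def normal_def by auto

lemma J_nu: "J (f p) (nu \<alpha> p) = df p (\<xi> \<alpha> p) + normal p (\<lambda>\<beta>. a p $ \<alpha> $ \<beta>)"
  using ind unfolding induced_structure_def normal_def by auto

lemma nu_along_diff: "along_diff M N f p (nu \<alpha>)"
  using frame unfolding orthonormal_normal_frame_def by (intro along_diff_vector_field_along) simp

lemma nu_df: "gt (f p) (nu \<alpha> p) (df p v) = 0"
  and nu_nu: "gt (f p) (nu \<alpha> p) (nu \<beta> p) = (if \<alpha> = \<beta> then 1 else 0)"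
  using frame unfolding orthonormal_normal_frame_def by auto

lemma cov_nu: "cov p v (nu \<alpha>) = - df p (A \<alpha> p v)"
  using wein unfolding weingarten_def by simp

lemma normal_nu: "gt (f p) (normal p x) (nu \<alpha> p) = x \<alpha>"
  by (simp add: normal_def linear_sum[OF gt_linear(1)] linear_scale[OF gt_linear(1)] nu_nu
      if_distrib[of "\<lambda>c. _ * c"] cong: if_cong)

lemma normal_df: "gt (f p) (normal p x) (df p v) = 0"
  by (simp add: normal_def linear_sum[OF gt_linear(1)] linear_scale[OF gt_linear(1)] nu_df)

lemma J_normal:
  "J (f p) (normal p x) =
    df p (\<Sum>\<alpha>\<in>UNIV. x \<alpha> *\<^sub>R \<xi> \<alpha> p) + normal p (\<lambda>\<beta>. \<Sum>\<alpha>\<in>UNIV. x \<alpha> * a p $ \<alpha> $ \<beta>)"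
proof -
  have "normal p (\<lambda>\<beta>. \<Sum>\<alpha>\<in>UNIV. x \<alpha> * a p $ \<alpha> $ \<beta>) =
      (\<Sum>\<alpha>\<in>UNIV. x \<alpha> *\<^sub>R normal p (\<lambda>\<beta>. a p $ \<alpha> $ \<beta>))"
    unfolding normal_def scaleR_sum_left scaleR_sum_right
    by (subst sum.swap) simp
  then show ?thesis
    unfolding normal_def[of p x]
    by (simp add: linear_sum[OF J_linear] linear_scale[OF J_linear] J_nu scaleR_add_right sum.distrib
        linear_sum[OF df_linear] linear_scale[OF df_linear])
qed

text \<open>Pairing with \<open>nu \<beta>\<close> kills the tangential part and reads off a
  coefficient; injectivity of \<open>df\<close> does the rest. Identities such as \<open>P_P\<close>
  and \<open>u_xi\<close> come from splitting ambient identities in this way.\<close>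

lemma decomposition_unique:
  assumes "df p v + normal p x = df p w + normal p y"
  shows "v = w" "x \<alpha> = y \<alpha>"
proof -
  have *: "x \<beta> = y \<beta>" for \<beta>
    using arg_cong[OF assms, of "\<lambda>z. gt (f p) z (nu \<beta> p)"] gt_sym[of "f p" "df p _"]
    by (simp add: linear_add[OF gt_linear(1)] normal_nu nu_df)
  then show "x \<alpha> = y \<alpha>" .
  have "x = y" using * by (rule ext)
  then show "v = w" using assms df_inj by simp
qed

text \<open>The tangential part of applying \<open>J\<close> twice to \<open>df p v\<close>.\<close>

lemma P_P: "P p (P p v) = v - (\<Sum>\<alpha>\<in>UNIV. u \<alpha> p v *\<^sub>R \<xi> \<alpha> p)"
proof -
  have "df p v + normal p (\<lambda>\<beta>. 0) = J (f p) (df p (P p v) + normal p (\<lambda>\<alpha>. u \<alpha> p v))"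
    using J_J[of "f p" "df p v"] by (simp add: J_df normal_def)
  also have "\<dots> = df p (P p (P p v) + (\<Sum>\<alpha>\<in>UNIV. u \<alpha> p v *\<^sub>R \<xi> \<alpha> p)) + normal p (\<lambda>\<beta>.
      u \<beta> p (P p v) + (\<Sum>\<alpha>\<in>UNIV. u \<alpha> p v * a p $ \<alpha> $ \<beta>))"
    unfolding linear_add[OF J_linear] J_df J_normal linear_add[OF df_linear] normal_add[symmetric]
    by simp
  finally have "v = P p (P p v) + (\<Sum>\<alpha>\<in>UNIV. u \<alpha> p v *\<^sub>R \<xi> \<alpha> p)" by (rule decomposition_unique(1))
  then show ?thesis by (simp add: eq_diff_eq)
qed

text \<open>The normal part of applying \<open>J\<close> twice to \<open>nu \<beta>\<close>. This is
  where the matrix of the determinant condition comes from.\<close>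

lemma u_xi: "u \<alpha> p (\<xi> \<beta> p) = (mat 1 - a p ** a p) $ \<beta> $ \<alpha>"
proof -
  \<comment> \<open>The left side is \<open>nu \<beta>\<close>, in the form that
    \<open>decomposition_unique\<close> expects.\<close>
  have "df p 0 + normal p (\<lambda>\<gamma>. if \<gamma> = \<beta> then 1 else 0) =
      J (f p) (df p (\<xi> \<beta> p) + normal p (\<lambda>\<gamma>. a p $ \<beta> $ \<gamma>))"
    using J_J[of "f p" "nu \<beta> p"]
    by (simp add: J_nu normal_def linear_0[OF df_linear] if_distrib[of "\<lambda>c. c *\<^sub>R _"] cong: if_cong)
  also have "\<dots> = df p (P p (\<xi> \<beta> p) + (\<Sum>\<gamma>\<in>UNIV. a p $ \<beta> $ \<gamma> *\<^sub>R \<xi> \<gamma> p)) + normal p (\<lambda>\<alpha>.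
      u \<alpha> p (\<xi> \<beta> p) + (\<Sum>\<gamma>\<in>UNIV. a p $ \<beta> $ \<gamma> * a p $ \<gamma> $ \<alpha>))"
    unfolding linear_add[OF J_linear] J_df J_normal linear_add[OF df_linear] normal_add[symmetric]
    by simp
  finally have "(if \<alpha> = \<beta> then 1 else 0) =
      u \<alpha> p (\<xi> \<beta> p) + (\<Sum>\<gamma>\<in>UNIV. a p $ \<beta> $ \<gamma> * a p $ \<gamma> $ \<alpha>)"
    by (rule decomposition_unique(2))
  then show ?thesis by (auto simp: mat_def matrix_matrix_mult_def)
qed

text \<open>\<open>P\<close> is the tangential compression of the self-adjoint
  \<open>J\<close>.\<close>

lemma P_symmetric: "g p (P p v) w = g p v (P p w)"
proof -
  have "g p (P p v) w = gt (f p) (J (f p) (df p v)) (df p w)" for v w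
    by (simp add: g_df J_df linear_add[OF gt_linear(1)] normal_df)
  then show ?thesis using J_symmetric gt_sym by (metis g_df)
qed

text \<open>Differentiating the orthogonality of \<open>nu \<alpha>\<close> and \<open>df Z\<close>
  expresses the second fundamental form through \<open>A \<alpha>\<close>. By
  \<open>cov_torsion_free\<close> its antisymmetric part pairs \<open>nu \<alpha>\<close> with
  \<open>df\<close> of a bracket, which gives zero.\<close>

lemma A_symmetric: "g p (A \<alpha> p v) w = g p v (A \<alpha> p w)"
proof -
  obtain X where X: "vector_field M X" "X p = v" by (rule vector_field_extension[OF M])
  obtain Y where Y: "vector_field M Y" "Y p = w" by (rule vector_field_extension[OF M])
  have *: "gt (f p) (df p (A \<alpha> p v)) (df p (Z p)) = gt (f p) (nu \<alpha> p) (cov p v (\<lambda>q. df q (Z q)))"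
    if "vector_field M Z" for Z v
    using cov_metric[OF nu_along_diff push_along_diff[OF that], of p \<alpha> v]
      has_tderiv_eq[OF has_tderiv_const[of M p "0::real"], of v]
    by (simp add: nu_df cov_nu linear_neg[OF gt_linear(1)])
  have "g p (A \<alpha> p v) w - g p (A \<alpha> p w) v =
      gt (f p) (nu \<alpha> p) (cov p (X p) (\<lambda>q. df q (Y q)) - cov p (Y p) (\<lambda>q. df q (X q)))"
    using *[OF X(1), of w] *[OF Y(1), of v] X(2) Y(2) by (simp add: g_df linear_diff[OF gt_linear(2)])
  also have "\<dots> = 0" unfolding cov_torsion_free[OF X(1) Y(1)] by (rule nu_df)
  finally show ?thesis using gt_sym by (simp add: g_df)
qed

section \<open>Computation of the normality tensor\<close>

text \<open>Differentiate \<open>J_df\<close>, solved for its tangential part. \<open>J\<close>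
  passes through by parallelism, and each \<open>nu \<alpha>\<close> contributes
  \<open>- df p (A \<alpha> p v)\<close>, whence the final plus sign.\<close>

lemma cov_P:
  assumes "vector_field M Y"
  shows "cov p v (\<lambda>q. df q (P q (Y q))) = J (f p) (cov p v (\<lambda>q. df q (Y q)))
    - normal p (\<lambda>\<alpha>. tderiv M p (\<lambda>q. u \<alpha> q (Y q)) v) + df p (\<Sum>\<alpha>\<in>UNIV. u \<alpha> p (Y p) *\<^sub>R A \<alpha> p v)"
proof -
  have nu: "along_diff M N f p (\<lambda>q. u \<alpha> q (Y q) *\<^sub>R nu \<alpha> q)"
    "cov p v (\<lambda>q. u \<alpha> q (Y q) *\<^sub>R nu \<alpha> q) =
      tderiv M p (\<lambda>q. u \<alpha> q (Y q)) v *\<^sub>R nu \<alpha> p - u \<alpha> p (Y p) *\<^sub>R df p (A \<alpha> p v)" for \<alpha>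
    using cov_scaleR[OF nu_along_diff u_tdiff[OF assms]] by (simp_all add: cov_nu)
  have s: "along_diff M N f p (\<lambda>q. normal q (\<lambda>\<alpha>. u \<alpha> q (Y q)))"
    "cov p v (\<lambda>q. normal q (\<lambda>\<alpha>. u \<alpha> q (Y q))) = normal p (\<lambda>\<alpha>. tderiv M p (\<lambda>q. u \<alpha> q (Y q)) v)
      - df p (\<Sum>\<alpha>\<in>UNIV. u \<alpha> p (Y p) *\<^sub>R A \<alpha> p v)"
    using cov_sum[of UNIV p "\<lambda>\<alpha> q. u \<alpha> q (Y q) *\<^sub>R nu \<alpha> q" v, OF nu(1)]
    by (simp_all add: nu(2) normal_def sum_subtractf linear_sum[OF df_linear] linear_scale[OF df_linear])
  have "J (f p) (cov p v (\<lambda>q. df q (Y q))) = cov p v (\<lambda>q. J (f q) (df q (Y q)))"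
    by (rule cov_parallel[OF push_along_diff[OF assms] J_tensor J_parallel, symmetric])
  also have "\<dots> = cov p v (\<lambda>q. df q (P q (Y q))) + cov p v (\<lambda>q. normal q (\<lambda>\<alpha>. u \<alpha> q (Y q)))"
    unfolding J_df by (rule cov_add(2)[OF push_along_diff[OF P_vector_field[OF assms]] s(1)])
  finally show ?thesis by (simp add: s(2))
qed

text \<open>\<open>cov_torsion_free\<close> turns the brackets into ambient derivatives and
  \<open>cov_P\<close> moves \<open>P\<close> out of them. The exterior derivatives absorb all terms
  containing \<open>\<xi>\<close>, and only Weingarten terms survive.\<close>

lemma normality_tensor:
  assumes X: "vector_field M X" and Y: "vector_field M Y"
  shows "nijenhuis M P X Y p - 2 *\<^sub>R (\<Sum>\<alpha>\<in>UNIV. ext_deriv M (u \<alpha>) X Y p *\<^sub>R \<xi> \<alpha> p) =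
    (\<Sum>\<alpha>\<in>UNIV. u \<alpha> p (X p) *\<^sub>R commutator \<alpha> p (Y p)) - (\<Sum>\<alpha>\<in>UNIV. u \<alpha> p (Y p) *\<^sub>R commutator \<alpha> p (X p))"
proof -
  note PX = P_vector_field[OF X] and PY = P_vector_field[OF Y]
  define x y where "x = X p" and "y = Y p"
  define L where "L = lie_bracket M X Y p"
  \<comment> \<open>The two mixed brackets enter the Nijenhuis tensor only through \<open>P\<close>
    of their sum.\<close>
  define Q where "Q = lie_bracket M (\<lambda>q. P q (X q)) Y p + lie_bracket M X (\<lambda>q. P q (Y q)) p"
  define R where "R = lie_bracket M (\<lambda>q. P q (X q)) (\<lambda>q. P q (Y q)) p"
  define Z where "Z = (\<Sum>\<alpha>\<in>UNIV. u \<alpha> p y *\<^sub>R A \<alpha> p x) - (\<Sum>\<alpha>\<in>UNIV. u \<alpha> p x *\<^sub>R A \<alpha> p y)"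
  define Z' where "Z' = (\<Sum>\<alpha>\<in>UNIV. u \<alpha> p y *\<^sub>R A \<alpha> p (P p x)) - (\<Sum>\<alpha>\<in>UNIV. u \<alpha> p x *\<^sub>R A \<alpha> p (P p y))"
  define c where "c v U = cov p v (\<lambda>q. df q (U q))" for v and U :: "'m \<Rightarrow> 'e"
  \<comment> \<open>\<open>W\<close> collects derivatives that do not form a bracket on
    \<open>M\<close>. It occurs in \<open>df p Q\<close> and, under \<open>J\<close>, in
    \<open>df p R\<close>, and is eliminated between the two.\<close>
  define W where "W = c (P p x) Y - c (P p y) X"
  define t where "t v U \<alpha> = tderiv M p (\<lambda>q. u \<alpha> q (U q)) v" for v and U :: "'m \<Rightarrow> 'e" and \<alpha>
  define n0 where "n0 \<alpha> = t y X \<alpha> - t x Y \<alpha>" for \<alpha>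
  have n0: "normal p n0 = normal p (t y X) - normal p (t x Y)"
    by (simp add: normal_diff n0_def[abs_def])
  note J_diff = linear_diff[OF J_linear] and J_add = linear_add[OF J_linear]
  note df_diff = linear_diff[OF df_linear] and df_add = linear_add[OF df_linear]
  have L: "df p L = c x Y - c y X"
    using cov_torsion_free[OF X Y, of p] by (simp add: L_def c_def x_def y_def)
  have "df p Q = (c (P p x) Y - c y (\<lambda>q. P q (X q))) + (c x (\<lambda>q. P q (Y q)) - c (P p y) X)"
    using cov_torsion_free[OF PX Y, of p] cov_torsion_free[OF X PY, of p]
    by (simp add: Q_def c_def x_def y_def df_add)
  also have "\<dots> = W + J (f p) (df p L) + df p Z + normal p (t y X) - normal p (t x Y)"
    unfolding W_def L Z_def c_def cov_P[OF X] cov_P[OF Y] J_diff df_diff t_def x_def y_def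
    by (simp add: algebra_simps)
  finally have W: "W = df p Q - J (f p) (df p L) - df p Z - normal p n0"
    by (simp add: n0 algebra_simps)
  have "df p R = c (P p x) (\<lambda>q. P q (Y q)) - c (P p y) (\<lambda>q. P q (X q))"
    using cov_torsion_free[OF PX PY, of p] by (simp add: R_def c_def x_def y_def)
  also have "\<dots> = J (f p) W + df p Z' + normal p (\<lambda>\<alpha>. t (P p y) X \<alpha> - t (P p x) Y \<alpha>)"
    unfolding W_def Z'_def c_def cov_P[OF X] cov_P[OF Y] J_diff df_diff t_def x_def y_def normal_diff[symmetric]
    by (simp add: algebra_simps)
  \<comment> \<open>As \<open>J\<close> is an involution, the term \<open>J (f p) (df p L)\<close>
    inside \<open>W\<close> returns as \<open>df p L\<close>.\<close>
  also have "J (f p) W = df p (P p Q - L - P p Z - (\<Sum>\<alpha>\<in>UNIV. n0 \<alpha> *\<^sub>R \<xi> \<alpha> p))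
      + normal p (\<lambda>\<beta>. u \<beta> p Q - u \<beta> p Z - (\<Sum>\<alpha>\<in>UNIV. n0 \<alpha> * a p $ \<alpha> $ \<beta>))"
  proof -
    have "J (f p) W = J (f p) (df p Q) - df p L - J (f p) (df p Z) - J (f p) (normal p n0)"
      unfolding W J_diff J_J ..
    then show ?thesis
      unfolding J_df J_normal df_diff normal_diff[symmetric] by (simp add: algebra_simps)
  qed
  finally have "df p R + normal p (\<lambda>\<alpha>. 0) =
      df p (P p Q - L - P p Z - (\<Sum>\<alpha>\<in>UNIV. n0 \<alpha> *\<^sub>R \<xi> \<alpha> p) + Z')
      + normal p (\<lambda>\<beta>. u \<beta> p Q - u \<beta> p Z - (\<Sum>\<alpha>\<in>UNIV. n0 \<alpha> * a p $ \<alpha> $ \<beta>)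
          + (t (P p y) X \<beta> - t (P p x) Y \<beta>))"
    unfolding df_add normal_add[symmetric] by (simp add: normal_def[of p "\<lambda>\<alpha>. 0"] algebra_simps)
  from decomposition_unique(1)[OF this]
  have R: "R = P p Q - L - P p Z - (\<Sum>\<alpha>\<in>UNIV. n0 \<alpha> *\<^sub>R \<xi> \<alpha> p) + Z'" .
  have N: "nijenhuis M P X Y p = R + P p (P p L) - P p Q"
    by (simp add: nijenhuis_def R_def L_def Q_def linear_add[OF P_linear])
  have "2 *\<^sub>R (\<Sum>\<alpha>\<in>UNIV. ext_deriv M (u \<alpha>) X Y p *\<^sub>R \<xi> \<alpha> p) =
      (\<Sum>\<alpha>\<in>UNIV. (t x Y \<alpha> - t y X \<alpha> - u \<alpha> p L) *\<^sub>R \<xi> \<alpha> p)"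
  proof -
    have "2 * ext_deriv M (u \<alpha>) X Y p = t x Y \<alpha> - t y X \<alpha> - u \<alpha> p L" for \<alpha>
      by (simp add: ext_deriv_def t_def L_def x_def y_def)
    then show ?thesis by (simp add: scaleR_sum_right)
  qed
  also have "\<dots> = - (\<Sum>\<alpha>\<in>UNIV. n0 \<alpha> *\<^sub>R \<xi> \<alpha> p) - (\<Sum>\<alpha>\<in>UNIV. u \<alpha> p L *\<^sub>R \<xi> \<alpha> p)"
    by (simp add: n0_def scaleR_diff_left sum_subtractf)
  \<comment> \<open>By \<open>P_P\<close> the term \<open>P p (P p L)\<close> cancels
    \<open>L\<close> and leaves the sum of \<open>u \<alpha> p L *\<^sub>R \<xi> \<alpha> p\<close>
    found in the exterior derivatives; the \<open>n0\<close> sums cancel as well.\<close>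
  finally have "nijenhuis M P X Y p - 2 *\<^sub>R (\<Sum>\<alpha>\<in>UNIV. ext_deriv M (u \<alpha>) X Y p *\<^sub>R \<xi> \<alpha> p) = Z' - P p Z"
    unfolding N R P_P by (simp add: algebra_simps)
  also have "\<dots> = (\<Sum>\<alpha>\<in>UNIV. u \<alpha> p x *\<^sub>R commutator \<alpha> p y) - (\<Sum>\<alpha>\<in>UNIV. u \<alpha> p y *\<^sub>R commutator \<alpha> p x)"
    by (simp add: Z_def Z'_def commutator_def linear_diff[OF P_linear] linear_sum[OF P_linear]
        linear_scale[OF P_linear] scaleR_diff_right sum_subtractf)
  finally show ?thesis by (simp add: x_def y_def)
qed

text \<open>By \<open>normality_tensor\<close> only the values of the fields at \<open>p\<close>
  matter, and \<open>vector_field_extension\<close> realises any two tangent vectors as such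
  values.\<close>

lemma normal_structure_iff:
  "normal_structure M P u \<xi> \<longleftrightarrow> (\<forall>p v w.
    (\<Sum>\<alpha>\<in>UNIV. u \<alpha> p v *\<^sub>R commutator \<alpha> p w) = (\<Sum>\<alpha>\<in>UNIV. u \<alpha> p w *\<^sub>R commutator \<alpha> p v))"
proof
  assume n: "normal_structure M P u \<xi>"
  show "\<forall>p v w.
    (\<Sum>\<alpha>\<in>UNIV. u \<alpha> p v *\<^sub>R commutator \<alpha> p w) = (\<Sum>\<alpha>\<in>UNIV. u \<alpha> p w *\<^sub>R commutator \<alpha> p v)"
  proof (intro allI)
    fix p v w
    obtain X where X: "vector_field M X" "X p = v" by (rule vector_field_extension[OF M])
    obtain Y where Y: "vector_field M Y" "Y p = w" by (rule vector_field_extension[OF M])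
    show "(\<Sum>\<alpha>\<in>UNIV. u \<alpha> p v *\<^sub>R commutator \<alpha> p w) = (\<Sum>\<alpha>\<in>UNIV. u \<alpha> p w *\<^sub>R commutator \<alpha> p v)"
      using n[unfolded normal_structure_def, rule_format, OF X(1) Y(1), of p]
        normality_tensor[OF X(1) Y(1), of p] X(2) Y(2) by simp
  qed
next
  assume "\<forall>p v w.
    (\<Sum>\<alpha>\<in>UNIV. u \<alpha> p v *\<^sub>R commutator \<alpha> p w) = (\<Sum>\<alpha>\<in>UNIV. u \<alpha> p w *\<^sub>R commutator \<alpha> p v)"
  then show "normal_structure M P u \<xi>"
    unfolding normal_structure_def by (simp add: normality_tensor)
qed

lemma dual_basis:
  assumes "det (mat 1 - a p ** a p) \<noteq> 0"
  obtains e where "\<And>\<alpha> \<beta>. u \<alpha> p (e \<beta>) = (if \<alpha> = \<beta> then 1 else 0)"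
proof -
  obtain K where K: "K ** (mat 1 - a p ** a p) = mat 1"
    using assms invertible_det_nz[of "mat 1 - a p ** a p"] invertible_left_inverse by blast
  \<comment> \<open>The rows of a left inverse are the coefficients: in \<open>u_xi\<close> the
    index of \<open>\<xi>\<close> is the row index, so summing over \<open>\<gamma>\<close> gives a
    product with \<open>K\<close> on the left.\<close>
  define e where "e \<beta> = (\<Sum>\<gamma>\<in>UNIV. K $ \<beta> $ \<gamma> *\<^sub>R \<xi> \<gamma> p)" for \<beta>
  have "u \<alpha> p (e \<beta>) = (K ** (mat 1 - a p ** a p)) $ \<beta> $ \<alpha>" for \<alpha> \<beta>
    by (simp add: e_def linear_sum[OF u_linear] linear_scale[OF u_linear] u_xi matrix_matrix_mult_def
        del: vector_minus_component)
  then have "u \<alpha> p (e \<beta>) = (if \<alpha> = \<beta> then 1 else 0)" for \<alpha> \<beta>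
    unfolding K by (auto simp: mat_def)
  then show ?thesis by (rule that)
qed

lemma normal_iff_commute:
  assumes "\<forall>p. det (mat 1 - a p ** a p) \<noteq> 0"
  shows "normal_structure M P u \<xi> \<longleftrightarrow> (\<forall>\<alpha> p v. P p (A \<alpha> p v) = A \<alpha> p (P p v))"
proof
  assume "normal_structure M P u \<xi>"
  then have S: "(\<Sum>\<alpha>\<in>UNIV. u \<alpha> p v *\<^sub>R commutator \<alpha> p w) = (\<Sum>\<alpha>\<in>UNIV. u \<alpha> p w *\<^sub>R commutator \<alpha> p v)"
    for p v w unfolding normal_structure_iff by blast
  have gM: "riemannian_metric M g" using imm unfolding isometric_immersion_def by blast
  show "\<forall>\<alpha> p v. P p (A \<alpha> p v) = A \<alpha> p (P p v)"
  proof (intro allI)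
    fix \<alpha> p v
    obtain e where e: "\<And>\<alpha> \<beta>. u \<alpha> p (e \<beta>) = (if \<alpha> = \<beta> then 1 else 0)"
      using assms dual_basis by blast
    have g: "bilinear (g p)" "\<And>v w. g p v w = g p w v" "\<And>v. v \<noteq> 0 \<Longrightarrow> g p v v > 0"
      using gM unfolding riemannian_metric_def by blast+
    have gl: "linear (\<lambda>x. g p x z)" "linear (g p z)" for z using g(1) unfolding bilinear_def by blast+
    \<comment> \<open>The commutator of two self-adjoint operators is skew-adjoint.\<close>
    have "g p (commutator \<beta> p v) w = - g p v (commutator \<beta> p w)" for \<beta> v w
      by (simp add: commutator_def linear_diff[OF gl(1)] linear_diff[OF gl(2)] P_symmetric A_symmetric)
    from antisymmetric_operators_vanish[OF g this S e] show "P p (A \<alpha> p v) = A \<alpha> p (P p v)"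
      by (simp add: commutator_def)
  qed
next
  assume "\<forall>\<alpha> p v. P p (A \<alpha> p v) = A \<alpha> p (P p v)"
  then show "normal_structure M P u \<xi>" unfolding normal_structure_iff by (simp add: commutator_def)
qed

end

theorem theorem4p2:
  fixes M :: "('m::{t2_space,second_countable_topology}, 'e::euclidean_space) atlas"
    and N :: "('b::{t2_space,second_countable_topology}, 'f::euclidean_space) atlas"
    and g :: "'m \<Rightarrow> 'e \<Rightarrow> 'e \<Rightarrow> real" and gt :: "'b \<Rightarrow> 'f \<Rightarrow> 'f \<Rightarrow> real"
    and Pt :: "'b \<Rightarrow> 'f \<Rightarrow> 'f" and Dt :: "'b \<Rightarrow> 'f \<Rightarrow> ('b \<Rightarrow> 'f) \<Rightarrow> 'f"
    and f :: "'m \<Rightarrow> 'b" and nu :: "'r::finite \<Rightarrow> 'm \<Rightarrow> 'f"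
    and P :: "'m \<Rightarrow> 'e \<Rightarrow> 'e" and u :: "'r \<Rightarrow> 'm \<Rightarrow> 'e \<Rightarrow> real" and \<xi> :: "'r \<Rightarrow> 'm \<Rightarrow> 'e"
    and a :: "'m \<Rightarrow> real^'r^'r"
    and A :: "'r \<Rightarrow> 'm \<Rightarrow> 'e \<Rightarrow> 'e" and l :: "'r \<Rightarrow> 'r \<Rightarrow> 'm \<Rightarrow> 'e \<Rightarrow> real"
  assumes "smooth_manifold M" and "smooth_manifold N"
    and "DIM('f) = DIM('e) + CARD('r)"
    and "locally_product_riemannian N gt Dt Pt"
    and "isometric_immersion M g N gt f"
    and "orthonormal_normal_frame M N gt f nu"
    and "induced_structure M N Pt f nu P u \<xi> a"
    and "weingarten M N Dt f nu A l"
    and "\<forall>\<alpha> \<beta> p v. l \<alpha> \<beta> p v = 0"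
    and "\<forall>p. det (mat 1 - a p ** a p) \<noteq> 0"
  shows "normal_structure M P u \<xi> \<longleftrightarrow>
           (\<forall>\<alpha> p v. P p (A \<alpha> p v) = A \<alpha> p (P p v))"
proof -
  \<comment> \<open>Pointwise vanishing becomes an equality of functions, so that the Weingarten
    hypothesis takes the form stated in the locale.\<close>
  have "l = (\<lambda>_ _ _ _. 0)" using assms(9) by (intro ext) simp
  then interpret product_submanifold M N f gt Dt g Pt nu P u \<xi> a A
    using assms(1,2,4-8)
    by unfold_locales
      (simp_all add: locally_product_riemannian_def almost_product_riemannian_def isometric_immersion_def)
  show ?thesis by (rule normal_iff_commute[OF assms(10)])
qed

end
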